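(* Let $\Gamma$ be a finite Coxeter graph such that every edge label is divisible by $4$. Then every Coxeter group $W$ with $\widehat W\cong\widehat{W_\Gamma}$ is isomorphic to $W_\Gamma$.
   Context: For a finite simplicial graph $\Gamma$ with edge labels $m\colon E(\Gamma)\to\mathbb{N}_{\ge2}$, $W_\Gamma=\langle V(\Gamma)\mid v^2,\ (vw)^{m(\{v,w\})}\text{ for }\{v,w\}\in E(\Gamma)\rangle$. $\widehat{G}$ is profinite completion. *)

theory Defs
  imports "HOL-Algebra.Algebra"
begin

text \<open>A finite Coxeter graph: finite vertex set V, edge set E of 2-element subsets of V,
  edge labels lbl e \<ge> 2 for e in E. Non-adjacent vertices impose no relation.\<close>

definition coxeter_graph :: "'v set \<Rightarrow> 'v set set \<Rightarrow> ('v set \<Rightarrow> nat) \<Rightarrow> bool" where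
  "coxeter_graph V E lbl \<longleftrightarrow> finite V
     \<and> E \<subseteq> {{v, w} | v w. v \<in> V \<and> w \<in> V \<and> v \<noteq> w}
     \<and> (\<forall>e\<in>E. 2 \<le> lbl e)"

text \<open>Defining relators of W_Gamma, as words in the generators (each generator is an
  involution, so words over V suffice).\<close>

definition cox_relators :: "'v set \<Rightarrow> 'v set set \<Rightarrow> ('v set \<Rightarrow> nat) \<Rightarrow> 'v list set" where
  "cox_relators V E lbl =
     {[v, v] | v. v \<in> V} \<union>
     {concat (replicate (lbl {v, w}) [v, w]) | v w. v \<in> V \<and> w \<in> V \<and> v \<noteq> w \<and> {v, w} \<in> E}"

inductive cox_rel :: "'v set \<Rightarrow> 'v set set \<Rightarrow> ('v set \<Rightarrow> nat) \<Rightarrow> 'v list \<Rightarrow> 'v list \<Rightarrow> bool"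
  for V E lbl where
  refl: "cox_rel V E lbl xs xs"
| sym: "cox_rel V E lbl xs ys \<Longrightarrow> cox_rel V E lbl ys xs"
| trans: "cox_rel V E lbl xs ys \<Longrightarrow> cox_rel V E lbl ys zs \<Longrightarrow> cox_rel V E lbl xs zs"
| relator: "r \<in> cox_relators V E lbl \<Longrightarrow> cox_rel V E lbl (xs @ r @ ys) (xs @ ys)"

definition cox_equiv :: "'v set \<Rightarrow> 'v set set \<Rightarrow> ('v set \<Rightarrow> nat) \<Rightarrow> ('v list \<times> 'v list) set" where
  "cox_equiv V E lbl = {(xs, ys). xs \<in> lists V \<and> ys \<in> lists V \<and> cox_rel V E lbl xs ys}"

definition coxeter_group :: "'v set \<Rightarrow> 'v set set \<Rightarrow> ('v set \<Rightarrow> nat) \<Rightarrow> 'v list set monoid" where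
  "coxeter_group V E lbl =
     \<lparr> carrier = lists V // cox_equiv V E lbl,
       monoid.mult = (\<lambda>A B. {zs \<in> lists V. \<exists>xs\<in>A. \<exists>ys\<in>B. cox_rel V E lbl zs (xs @ ys)}),
       one = cox_equiv V E lbl `` {[]} \<rparr>"

definition fin_normals :: "('a, 'b) monoid_scheme \<Rightarrow> 'a set set" where
  "fin_normals G = {N. N \<lhd> G \<and> finite (rcosets\<^bsub>G\<^esub> N)}"

text \<open>The profinite completion: inverse limit of the finite quotients G/N, realised as
  compatible families of cosets indexed by the finite-index normal subgroups.\<close>

definition profinite_completion :: "('a, 'b) monoid_scheme \<Rightarrow> ('a set \<Rightarrow> 'a set) monoid" where
  "profinite_completion G =
     \<lparr> carrier = {f. (\<forall>N\<in>fin_normals G. f N \<in> rcosets\<^bsub>G\<^esub> N)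
                 \<and> (\<forall>N\<in>fin_normals G. \<forall>M\<in>fin_normals G. N \<subseteq> M \<longrightarrow> f N \<subseteq> f M)
                 \<and> (\<forall>N. N \<notin> fin_normals G \<longrightarrow> f N = {})},
       monoid.mult = (\<lambda>f g N. if N \<in> fin_normals G then f N <#>\<^bsub>G\<^esub> g N else {}),
       one = (\<lambda>N. if N \<in> fin_normals G then N else {}) \<rparr>"

text \<open>Kernel of the projection of the completion onto G/N (basic open normal subgroups).\<close>

definition prof_kernel :: "('a, 'b) monoid_scheme \<Rightarrow> 'a set \<Rightarrow> ('a set \<Rightarrow> 'a set) set" where
  "prof_kernel G N = {f \<in> carrier (profinite_completion G). f N = N}"

text \<open>Isomorphism of profinite completions as topological groups: a group isomorphism
  which is continuous in both directions (continuity of a homomorphism at the identity,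
  tested against the basic open normal subgroups).\<close>

definition profinite_iso :: "('a, 'b) monoid_scheme \<Rightarrow> ('c, 'd) monoid_scheme \<Rightarrow> bool" where
  "profinite_iso G H \<longleftrightarrow> (\<exists>\<phi>. \<phi> \<in> iso (profinite_completion G) (profinite_completion H)
     \<and> (\<forall>N\<in>fin_normals H. \<exists>M\<in>fin_normals G. \<phi> ` prof_kernel G M \<subseteq> prof_kernel H N)
     \<and> (\<forall>M\<in>fin_normals G. \<exists>N\<in>fin_normals H. \<forall>x\<in>carrier (profinite_completion G).
            \<phi> x \<in> prof_kernel H N \<longrightarrow> x \<in> prof_kernel G M))"

end

(* Write W' for the Coxeter group of (V', E', m'). An isomorphism of profinite completions identifies,
   naturally in the finite group G, homomorphisms from W_Gamma to G with homomorphisms from W' to G.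
   Since all labels of Gamma are divisible by 4, Hom(W_Gamma, Z/2) is the space of all functions on V.
   The maps W_Gamma -> D_4 sending two vertices to generating reflections and all others to 1 show that
   a generator of W', being an involution, pairs nontrivially with exactly one delta function; this
   defines a map color: V' -> V. It is constant on edges with odd label. Maps to dihedral groups show
   that an edge of Gamma' joining different colors lies over an edge of Gamma whose label divides its
   own, so color induces a homomorphism from W' to W_Gamma. As the number of homomorphisms to each
   finite group is the same, every homomorphism from W' to a finite group factors through it. But the
   two ends of an edge with odd label are separated by a finite quotient of W', a reflection
   representation over a finite field of characteristic 2. Hence Gamma' has no odd label, color is
   bijective, and factoring the dihedral quotients of W' through W_Gamma gives the reverse
   divisibility of labels. *)

theory Submission
  imports Defs "HOL-Library.Z2" "HOL-Number_Theory.Residues"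
    "HOL-Algebra.Algebraic_Closure_Type"
begin

text \<open>The isomorphism of completions need not match generators with generators, so the
  transfer \<open>tr\<close> cannot be taken to be composition with \<open>color\<close>. Naturality
  only tells what a transferred value becomes in Z/2, in a quotient or in a subgroup, and the steps
  up to the labels use no more than that.

  The number 4 enters through involutions. In D_4 a rotation by an odd number of steps has order 4,
  so no involution is nontrivial under both characters dual to the generating reflections; in D_2
  every element squares to 1 and nothing would be excluded.

  For the labels, the obstacle is that the transferred reflections at two adjacent generators differ
  by a rotation known only to be odd, which need not generate the rotations of D_n. An odd prime
  dividing both the rotation and n is excluded modulo p, where a rotation that squares to 1 is
  trivial.

  Nothing is known beforehand about the labels of the second graph. The separating representation
  therefore lets vertices joined by an even label commute and couples only those joined by an odd
  one, through roots of unity of odd order.\<close>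

section \<open>The universal property of Coxeter groups\<close>

text \<open>Encodes Hom(W_Gamma, G) by the images of the generators. Extensionality off
  \<open>V\<close> makes equal homomorphisms equal functions, and the set finite for finite
  \<open>V\<close> and \<open>G\<close>, so that Hom sets can be counted.\<close>

definition cox_maps ::
  "'v set \<Rightarrow> 'v set set \<Rightarrow> ('v set \<Rightarrow> nat) \<Rightarrow> ('g, 'z) monoid_scheme \<Rightarrow> ('v \<Rightarrow> 'g) set" where
  "cox_maps V E m G = {s \<in> V \<rightarrow>\<^sub>E carrier G.
     (\<forall>v\<in>V. s v \<otimes>\<^bsub>G\<^esub> s v = \<one>\<^bsub>G\<^esub>) \<and>
     (\<forall>v\<in>V. \<forall>w\<in>V. v \<noteq> w \<longrightarrow> {v, w} \<in> E \<longrightarrow> (s v \<otimes>\<^bsub>G\<^esub> s w) [^]\<^bsub>G\<^esub> m {v, w} = \<one>\<^bsub>G\<^esub>)}"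

definition word_eval :: "('g, 'z) monoid_scheme \<Rightarrow> ('v \<Rightarrow> 'g) \<Rightarrow> 'v list \<Rightarrow> 'g" where
  "word_eval G s xs = foldr (\<lambda>v g. s v \<otimes>\<^bsub>G\<^esub> g) xs \<one>\<^bsub>G\<^esub>"

definition cox_class :: "'v set \<Rightarrow> 'v set set \<Rightarrow> ('v set \<Rightarrow> nat) \<Rightarrow> 'v list \<Rightarrow> 'v list set" where
  "cox_class V E m xs = cox_equiv V E m `` {xs}"

definition cox_lift :: "('g, 'z) monoid_scheme \<Rightarrow> ('v \<Rightarrow> 'g) \<Rightarrow> 'v list set \<Rightarrow> 'g" where
  "cox_lift G s A = the_elem (word_eval G s ` A)"

lemma cox_mapsD:
  assumes "s \<in> cox_maps V E m G"
  shows "s \<in> V \<rightarrow>\<^sub>E carrier G" "v \<in> V \<Longrightarrow> s v \<in> carrier G" "v \<in> V \<Longrightarrow> s v \<otimes>\<^bsub>G\<^esub> s v = \<one>\<^bsub>G\<^esub>"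
    "v \<in> V \<Longrightarrow> w \<in> V \<Longrightarrow> v \<noteq> w \<Longrightarrow> {v, w} \<in> E \<Longrightarrow> (s v \<otimes>\<^bsub>G\<^esub> s w) [^]\<^bsub>G\<^esub> m {v, w} = \<one>\<^bsub>G\<^esub>"
  using assms by (auto simp: cox_maps_def)

lemma cox_maps_ext:
  assumes "s \<in> cox_maps V E m G" "t \<in> cox_maps V E m G" "\<And>v. v \<in> V \<Longrightarrow> s v = t v"
  shows "s = t"
  using PiE_ext[OF cox_mapsD(1)[OF assms(1)] cox_mapsD(1)[OF assms(2)]] assms(3) by blast

lemma finite_cox_maps:
  assumes "finite V" "finite (carrier G)"
  shows "finite (cox_maps V E m G)"
  by (rule finite_subset[OF _ finite_PiE[of V "\<lambda>_. carrier G"]]) (use assms in \<open>auto simp: cox_maps_def\<close>)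

section \<open>Words in the generators and their evaluation\<close>

lemma (in group) word_eval_closed:
  assumes "s \<in> V \<rightarrow> carrier G" "xs \<in> lists V"
  shows "word_eval G s xs \<in> carrier G"
  using assms(2,1) by (induction xs) (auto simp: word_eval_def)

lemma word_eval_Nil [simp]: "word_eval G s [] = \<one>\<^bsub>G\<^esub>"
  and word_eval_Cons [simp]: "word_eval G s (x # xs) = s x \<otimes>\<^bsub>G\<^esub> word_eval G s xs"
  by (simp_all add: word_eval_def)

lemma (in group) word_eval_append:
  assumes "s \<in> V \<rightarrow> carrier G" "xs \<in> lists V" "ys \<in> lists V"
  shows "word_eval G s (xs @ ys) = word_eval G s xs \<otimes> word_eval G s ys"
  using assms(2)
proof (induction xs)
  case Nil
  show ?case using word_eval_closed[OF assms(1,3)] by simp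
next
  case (Cons x xs)
  have "s x \<in> carrier G" using assms(1) Cons(1) by auto
  then show ?case
    using Cons word_eval_closed[OF assms(1,3)] word_eval_closed[OF assms(1) Cons(2)] by (simp add: m_assoc)
qed

lemma (in group) word_eval_replicate:
  assumes "s \<in> V \<rightarrow> carrier G" "v \<in> V" "w \<in> V"
  shows "word_eval G s (concat (replicate n [v, w])) = (s v \<otimes> s w) [^] n"
proof (induction n)
  case (Suc n)
  have "s v \<in> carrier G" "s w \<in> carrier G" using assms by auto
  then show ?case
    using Suc nat_pow_Suc2[of "s v \<otimes> s w" n] by (simp add: m_assoc)
qed simp

lemma cox_relators_lists: "r \<in> cox_relators V E m \<Longrightarrow> r \<in> lists V"
  by (auto simp: cox_relators_def split: if_splits)

lemma (in group) word_eval_relator: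
  assumes "s \<in> cox_maps V E m G" "r \<in> cox_relators V E m"
  shows "word_eval G s r = \<one>"
proof -
  have s: "s \<in> V \<rightarrow> carrier G" using cox_mapsD(1)[OF assms(1)] by auto
  from assms(2) consider (a) v where "v \<in> V" "r = [v, v]"
    | (b) v w where "v \<in> V" "w \<in> V" "v \<noteq> w" "{v, w} \<in> E" "r = concat (replicate (m {v, w}) [v, w])"
    unfolding cox_relators_def by blast
  then show ?thesis
  proof cases
    case a
    then show ?thesis using cox_mapsD(2,3)[OF assms(1)] by simp
  next
    case b
    then show ?thesis using cox_mapsD(4)[OF assms(1)] word_eval_replicate[OF s] by simp
  qed
qed

text \<open>\<open>cox_rel\<close> lives on words with arbitrary letters. Relators only use letters
  of \<open>V\<close>, so a derivation starting in \<open>lists V\<close> stays there, as the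
  transitivity case of \<open>word_eval_cong\<close> requires.\<close>

lemma cox_rel_lists_iff:
  assumes "cox_rel V E m xs ys"
  shows "xs \<in> lists V \<longleftrightarrow> ys \<in> lists V"
  using assms by induction (auto dest: cox_relators_lists)

lemma (in group) word_eval_cong:
  assumes "cox_rel V E m xs ys" "xs \<in> lists V" "s \<in> cox_maps V E m G"
  shows "word_eval G s xs = word_eval G s ys"
  using assms(1,2)
proof induction
  case (relator r xs ys)
  have s: "s \<in> V \<rightarrow> carrier G" using cox_mapsD(1)[OF assms(3)] by auto
  have "xs \<in> lists V" "r \<in> lists V" "ys \<in> lists V" using relator by auto
  then show ?case
    using word_eval_relator[OF assms(3) relator(1)] s word_eval_closed[OF s]
    by (simp add: word_eval_append[OF s])
qed (auto simp: cox_rel_lists_iff)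

lemma cox_rel_context:
  assumes "cox_rel V E m xs ys"
  shows "cox_rel V E m (us @ xs @ vs) (us @ ys @ vs)"
  using assms
proof induction
  case (relator r xs ys)
  then show ?case using cox_rel.relator[of r V E m "us @ xs" "ys @ vs"] by simp
qed (auto intro: cox_rel.intros)

lemma cox_rel_append:
  assumes "cox_rel V E m xs ys" "cox_rel V E m us vs"
  shows "cox_rel V E m (xs @ us) (ys @ vs)"
  using cox_rel_context[OF assms(1), of "[]" us] cox_rel_context[OF assms(2), of ys "[]"]
  by (auto intro: cox_rel.trans)

text \<open>Generators are involutions, so reversing a word inverts it: the two equal letters
  meeting in the middle cancel.\<close>

lemma cox_rel_rev:
  assumes "xs \<in> lists V"
  shows "cox_rel V E m (rev xs @ xs) []"
  using assms
proof (induction xs)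
  case (Cons x xs)
  have "cox_rel V E m (rev xs @ [x, x] @ xs) (rev xs @ xs)"
    by (rule cox_rel.relator) (use Cons in \<open>auto simp: cox_relators_def\<close>)
  then show ?case using Cons by (auto intro: cox_rel.trans)
qed (auto intro: cox_rel.intros)

section \<open>The group of word classes\<close>

lemma equiv_cox_equiv: "equiv (lists V) (cox_equiv V E m)"
  by (rule equivI)
    (auto simp: cox_equiv_def refl_on_def sym_def trans_def intro: cox_rel.intros)

lemma mem_cox_class:
  "xs \<in> lists V \<Longrightarrow> ys \<in> cox_class V E m xs \<longleftrightarrow> ys \<in> lists V \<and> cox_rel V E m xs ys"
  by (auto simp: cox_class_def cox_equiv_def)

lemma cox_class_eq_iff:
  "xs \<in> lists V \<Longrightarrow> ys \<in> lists V \<Longrightarrow> cox_class V E m xs = cox_class V E m ys \<longleftrightarrow> cox_rel V E m xs ys"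
  using eq_equiv_class_iff[OF equiv_cox_equiv, of xs V ys E m]
  by (simp add: cox_class_def cox_equiv_def)

lemma carrier_coxeter_group: "carrier (coxeter_group V E m) = cox_class V E m ` lists V"
  by (auto simp: coxeter_group_def quotient_def cox_class_def)

lemma one_coxeter_group: "\<one>\<^bsub>coxeter_group V E m\<^esub> = cox_class V E m []"
  by (simp add: coxeter_group_def cox_class_def)

lemma mult_coxeter_group:
  assumes "xs \<in> lists V" "ys \<in> lists V"
  shows "cox_class V E m xs \<otimes>\<^bsub>coxeter_group V E m\<^esub> cox_class V E m ys = cox_class V E m (xs @ ys)"
  (is "?l = ?r")
proof
  show "?l \<subseteq> ?r"
  proof
    fix zs assume "zs \<in> ?l"
    then obtain xs' ys' where "zs \<in> lists V" "cox_rel V E m xs xs'" "cox_rel V E m ys ys'"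
      "cox_rel V E m zs (xs' @ ys')"
      using mem_cox_class[OF assms(1)] mem_cox_class[OF assms(2)] by (auto simp: coxeter_group_def)
    then show "zs \<in> ?r"
      using assms cox_rel_append[of V E m xs xs' ys ys']
      by (auto simp: mem_cox_class intro: cox_rel.trans cox_rel.sym)
  qed
  show "?r \<subseteq> ?l"
  proof
    fix zs assume "zs \<in> ?r"
    moreover have "xs @ ys \<in> lists V" using assms by simp
    ultimately have "zs \<in> lists V" "cox_rel V E m zs (xs @ ys)"
      using mem_cox_class[of "xs @ ys" V zs E m] by (auto intro: cox_rel.sym)
    moreover have "xs \<in> cox_class V E m xs" "ys \<in> cox_class V E m ys"
      using assms mem_cox_class[of _ V _ E m] cox_rel.refl[of V E m] by blast+
    ultimately show "zs \<in> ?l"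
      by (auto simp: coxeter_group_def)
  qed
qed

lemma group_coxeter_group: "group (coxeter_group V E m)"
proof (rule groupI)
  let ?G = "coxeter_group V E m"
  fix x y z assume "x \<in> carrier ?G" "y \<in> carrier ?G"
  then obtain xs ys where xy: "xs \<in> lists V" "ys \<in> lists V" "x = cox_class V E m xs" "y = cox_class V E m ys"
    by (auto simp: carrier_coxeter_group)
  then show "x \<otimes>\<^bsub>?G\<^esub> y \<in> carrier ?G"
    by (auto simp: carrier_coxeter_group mult_coxeter_group)
  assume "z \<in> carrier ?G"
  then obtain zs where "zs \<in> lists V" "z = cox_class V E m zs"
    by (auto simp: carrier_coxeter_group)
  then show "x \<otimes>\<^bsub>?G\<^esub> y \<otimes>\<^bsub>?G\<^esub> z = x \<otimes>\<^bsub>?G\<^esub> (y \<otimes>\<^bsub>?G\<^esub> z)"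
    using xy by (simp add: mult_coxeter_group)
next
  let ?G = "coxeter_group V E m"
  fix x assume "x \<in> carrier ?G"
  then obtain xs where xs: "xs \<in> lists V" "x = cox_class V E m xs"
    by (auto simp: carrier_coxeter_group)
  then show "\<one>\<^bsub>?G\<^esub> \<otimes>\<^bsub>?G\<^esub> x = x"
    by (simp add: one_coxeter_group mult_coxeter_group)
  have "rev xs \<in> lists V" using xs by auto
  then show "\<exists>y\<in>carrier ?G. y \<otimes>\<^bsub>?G\<^esub> x = \<one>\<^bsub>?G\<^esub>"
    using xs cox_rel_rev[OF xs(1), of E m]
    by (intro bexI[of _ "cox_class V E m (rev xs)"])
      (auto simp: one_coxeter_group mult_coxeter_group cox_class_eq_iff carrier_coxeter_group)
qed (auto simp: one_coxeter_group carrier_coxeter_group)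

section \<open>Homomorphisms given by the images of the generators\<close>

lemma (in group) cox_lift_class:
  assumes "s \<in> cox_maps V E m G" "xs \<in> lists V"
  shows "cox_lift G s (cox_class V E m xs) = word_eval G s xs"
proof -
  have "word_eval G s ys = word_eval G s xs" if "ys \<in> cox_class V E m xs" for ys
    using word_eval_cong[OF _ assms(2,1), of ys] that mem_cox_class[OF assms(2)] by metis
  moreover have "xs \<in> cox_class V E m xs"
    using mem_cox_class[OF assms(2)] assms(2) cox_rel.refl by metis
  ultimately have "word_eval G s ` cox_class V E m xs = {word_eval G s xs}"
    by blast
  then show ?thesis by (simp add: cox_lift_def)
qed

lemma (in group) cox_lift_hom:
  assumes s: "s \<in> cox_maps V E m G"
  shows "cox_lift G s \<in> hom (coxeter_group V E m) G"
proof -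
  have s': "s \<in> V \<rightarrow> carrier G" using cox_mapsD(1)[OF s] by auto
  show ?thesis
  proof (rule homI)
    fix x y assume "x \<in> carrier (coxeter_group V E m)"
    then obtain xs where xs: "xs \<in> lists V" "x = cox_class V E m xs"
      unfolding carrier_coxeter_group by blast
    then show "cox_lift G s x \<in> carrier G"
      by (simp add: cox_lift_class[OF s] word_eval_closed[OF s'] del: in_lists_conv_set)
    assume "y \<in> carrier (coxeter_group V E m)"
    then obtain ys where ys: "ys \<in> lists V" "y = cox_class V E m ys"
      unfolding carrier_coxeter_group by blast
    have "xs @ ys \<in> lists V" using xs ys by simp
    with xs ys show "cox_lift G s (x \<otimes>\<^bsub>coxeter_group V E m\<^esub> y) = cox_lift G s x \<otimes> cox_lift G s y"
      by (simp add: cox_lift_class[OF s] word_eval_append[OF s'] mult_coxeter_group del: in_lists_conv_set)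
  qed
qed

lemma (in group) cox_lift_gen:
  assumes "s \<in> cox_maps V E m G" "v \<in> V"
  shows "cox_lift G s (cox_class V E m [v]) = s v"
  using assms cox_mapsD(2)[OF assms(1)] by (simp add: cox_lift_class)

lemma hom_eq_on_gens:
  assumes "f \<in> hom (coxeter_group V E m) G" "g \<in> hom (coxeter_group V E m) G" "group G"
    and eq: "\<And>v. v \<in> V \<Longrightarrow> f (cox_class V E m [v]) = g (cox_class V E m [v])"
    and A: "A \<in> carrier (coxeter_group V E m)"
  shows "f A = g A"
proof -
  interpret W: group "coxeter_group V E m" by (rule group_coxeter_group)
  obtain xs where "xs \<in> lists V" "A = cox_class V E m xs"
    using A by (auto simp: carrier_coxeter_group)
  moreover have "f (cox_class V E m xs) = g (cox_class V E m xs)" if "xs \<in> lists V" for xs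
    using that
  proof (induction xs)
    case Nil
    then show ?case
      using hom_one[OF assms(1) W.group_axioms assms(3)] hom_one[OF assms(2) W.group_axioms assms(3)]
      by (simp add: one_coxeter_group)
  next
    case (Cons x xs)
    have *: "cox_class V E m (x # xs) = cox_class V E m [x] \<otimes>\<^bsub>coxeter_group V E m\<^esub> cox_class V E m xs"
      using Cons by (subst mult_coxeter_group) auto
    have "cox_class V E m [x] \<in> carrier (coxeter_group V E m)"
      "cox_class V E m xs \<in> carrier (coxeter_group V E m)"
      using Cons by (auto simp: carrier_coxeter_group)
    then show ?case
      using Cons eq hom_mult[OF assms(1)] hom_mult[OF assms(2)] by (simp add: *)
  qed
  ultimately show ?thesis by simp
qed

lemma gen_pow:
  assumes "v \<in> V" "w \<in> V"
  shows "(cox_class V E m [v] \<otimes>\<^bsub>coxeter_group V E m\<^esub> cox_class V E m [w]) [^]\<^bsub>coxeter_group V E m\<^esub> n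
    = cox_class V E m (concat (replicate n [v, w]))"
proof -
  interpret W: group "coxeter_group V E m" by (rule group_coxeter_group)
  show ?thesis
  proof (induction n)
    case 0
    then show ?case by (simp add: one_coxeter_group)
  next
    case (Suc n)
    have *: "cox_class V E m [v] \<otimes>\<^bsub>coxeter_group V E m\<^esub> cox_class V E m [w] = cox_class V E m [v, w]"
      using assms by (simp add: mult_coxeter_group)
    have "cox_class V E m [v, w] \<in> carrier (coxeter_group V E m)"
      using assms by (auto simp: carrier_coxeter_group)
    moreover have "concat (replicate n [v, w]) \<in> lists V"
      using assms by (auto split: if_splits)
    ultimately show ?case
      using Suc W.nat_pow_Suc2[of "cox_class V E m [v, w]" n] assms by (simp add: * mult_coxeter_group)
  qed
qed

text \<open>The universal element: through \<open>cox_maps_comp\<close>, every homomorphism out of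
  the Coxeter group yields a member of \<open>cox_maps\<close>.\<close>

lemma gens_cox_maps: "(\<lambda>v\<in>V. cox_class V E m [v]) \<in> cox_maps V E m (coxeter_group V E m)"
proof -
  have "cox_rel V E m ([] @ r @ []) ([] @ [])" if "r \<in> cox_relators V E m" for r
    using that by (rule cox_rel.relator)
  then have rel: "cox_class V E m r = cox_class V E m []" if "r \<in> cox_relators V E m" for r
    using that cox_relators_lists[OF that] by (simp add: cox_class_eq_iff)
  have "cox_class V E m [v, v] = cox_class V E m []" if "v \<in> V" for v
    by (rule rel) (use that in \<open>auto simp: cox_relators_def\<close>)
  moreover have "cox_class V E m (concat (replicate (m {v, w}) [v, w])) = cox_class V E m []"
    if "v \<in> V" "w \<in> V" "v \<noteq> w" "{v, w} \<in> E" for v w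
    by (rule rel) (use that in \<open>unfold cox_relators_def, blast\<close>)
  ultimately show ?thesis
    using gen_pow[of _ V _ E m]
    by (simp add: cox_maps_def mult_coxeter_group one_coxeter_group carrier_coxeter_group)
qed

lemma hom_pow:
  assumes "f \<in> hom G H" "group G" "group H" "x \<in> carrier G"
  shows "f (x [^]\<^bsub>G\<^esub> (n::nat)) = f x [^]\<^bsub>H\<^esub> n"
proof -
  interpret group_hom G H f using assms by (simp add: group_hom_def group_hom_axioms_def)
  show ?thesis using assms(4) by (rule hom_nat_pow)
qed

lemma cox_maps_comp:
  assumes s: "s \<in> cox_maps V E m G" and f: "f \<in> hom G H" and G: "group G" and H: "group H"
  shows "(\<lambda>v\<in>V. f (s v)) \<in> cox_maps V E m H"
proof -
  interpret G: group G by fact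
  note s' = cox_mapsD[OF s]
  have "f (s v) \<otimes>\<^bsub>H\<^esub> f (s v) = \<one>\<^bsub>H\<^esub>" if "v \<in> V" for v
    using hom_mult[OF f s'(2) s'(2), OF that that] s'(3)[OF that] hom_one[OF f G H] by simp
  moreover have "(f (s v) \<otimes>\<^bsub>H\<^esub> f (s w)) [^]\<^bsub>H\<^esub> m {v, w} = \<one>\<^bsub>H\<^esub>"
    if "v \<in> V" "w \<in> V" "v \<noteq> w" "{v, w} \<in> E" for v w
  proof -
    have "f (s v) \<otimes>\<^bsub>H\<^esub> f (s w) = f (s v \<otimes>\<^bsub>G\<^esub> s w)"
      using hom_mult[OF f s'(2) s'(2), OF that(1,2)] by simp
    moreover have "f ((s v \<otimes>\<^bsub>G\<^esub> s w) [^]\<^bsub>G\<^esub> m {v, w}) = f (s v \<otimes>\<^bsub>G\<^esub> s w) [^]\<^bsub>H\<^esub> m {v, w}"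
      by (rule hom_pow[OF f G H]) (use s'(2) that in simp)
    ultimately show ?thesis using s'(4)[OF that] hom_one[OF f G H] by simp
  qed
  ultimately show ?thesis
    using s'(2) hom_in_carrier[OF f] by (auto simp: cox_maps_def)
qed

lemma hom_gens_cox_maps:
  assumes "f \<in> hom (coxeter_group V E m) G" "group G"
  shows "(\<lambda>v\<in>V. f (cox_class V E m [v])) \<in> cox_maps V E m G"
proof -
  have "(\<lambda>v\<in>V. f ((\<lambda>v\<in>V. cox_class V E m [v]) v)) \<in> cox_maps V E m G"
    by (rule cox_maps_comp[OF gens_cox_maps assms(1) group_coxeter_group assms(2)])
  then show ?thesis by (simp cong: restrict_cong)
qed

text \<open>The bijection and its inverse both respect the relators; their lifts are mutually
  inverse because they are so on generators.\<close>

lemma coxeter_group_iso: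
  assumes bij: "bij_betw \<theta> V' V"
    and edge: "\<And>a b. a \<in> V' \<Longrightarrow> b \<in> V' \<Longrightarrow> a \<noteq> b \<Longrightarrow> {a, b} \<in> E' \<longleftrightarrow> {\<theta> a, \<theta> b} \<in> E"
    and lab: "\<And>a b. a \<in> V' \<Longrightarrow> b \<in> V' \<Longrightarrow> a \<noteq> b \<Longrightarrow> {a, b} \<in> E' \<Longrightarrow> m' {a, b} = m {\<theta> a, \<theta> b}"
  shows "coxeter_group V' E' m' \<cong> coxeter_group V E m"
proof -
  let ?A = "coxeter_group V' E' m'" and ?B = "coxeter_group V E m"
  interpret A: group ?A by (rule group_coxeter_group)
  interpret B: group ?B by (rule group_coxeter_group)
  define \<eta> where "\<eta> = inv_into V' \<theta>"
  have th: "\<theta> a \<in> V" "\<eta> (\<theta> a) = a" if "a \<in> V'" for a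
    using that bij by (auto simp: \<eta>_def bij_betw_def inj_on_def)
  have et: "\<eta> x \<in> V'" "\<theta> (\<eta> x) = x" if "x \<in> V" for x
    using that bij by (auto simp: \<eta>_def bij_betw_def inv_into_into f_inv_into_f)
  note gA = cox_mapsD[OF gens_cox_maps[of V' E' m']] and gB = cox_mapsD[OF gens_cox_maps[of V E m]]
  have s: "(\<lambda>a\<in>V'. cox_class V E m [\<theta> a]) \<in> cox_maps V' E' m' ?B"
  proof -
    have "\<theta> a \<noteq> \<theta> b \<and> {\<theta> a, \<theta> b} \<in> E \<and> m' {a, b} = m {\<theta> a, \<theta> b}"
      if "a \<in> V'" "b \<in> V'" "a \<noteq> b" "{a, b} \<in> E'" for a b
      using that th[of a] th[of b] edge[of a b] lab[of a b] by metis
    then show ?thesis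
      using gB(2-4) th by (auto simp: cox_maps_def)
  qed
  have t: "(\<lambda>x\<in>V. cox_class V' E' m' [\<eta> x]) \<in> cox_maps V E m ?A"
  proof -
    have "\<eta> x \<noteq> \<eta> y \<and> {\<eta> x, \<eta> y} \<in> E' \<and> m {x, y} = m' {\<eta> x, \<eta> y}"
      if "x \<in> V" "y \<in> V" "x \<noteq> y" "{x, y} \<in> E" for x y
      using that et[of x] et[of y] edge[of "\<eta> x" "\<eta> y"] lab[of "\<eta> x" "\<eta> y"] by metis
    then show ?thesis
      using gA(2-4) et by (auto simp: cox_maps_def)
  qed
  let ?f = "cox_lift ?B (\<lambda>a\<in>V'. cox_class V E m [\<theta> a])"
  let ?g = "cox_lift ?A (\<lambda>x\<in>V. cox_class V' E' m' [\<eta> x])"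
  have f: "?f \<in> hom ?A ?B" and g: "?g \<in> hom ?B ?A"
    using B.cox_lift_hom[OF s] A.cox_lift_hom[OF t] by auto
  have "?g (?f x) = x" if "x \<in> carrier ?A" for x
  proof -
    have "(?g \<circ> ?f) x = id x"
      by (rule hom_eq_on_gens[OF hom_compose[OF f g] _ A.group_axioms _ that])
        (use th A.cox_lift_gen[OF t] B.cox_lift_gen[OF s] in \<open>auto simp: hom_def\<close>)
    then show ?thesis by simp
  qed
  moreover have "?f (?g x) = x" if "x \<in> carrier ?B" for x
  proof -
    have "(?f \<circ> ?g) x = id x"
      by (rule hom_eq_on_gens[OF hom_compose[OF g f] _ B.group_axioms _ that])
        (use et A.cox_lift_gen[OF t] B.cox_lift_gen[OF s] in \<open>auto simp: hom_def\<close>)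
    then show ?thesis by simp
  qed
  ultimately have "group_isomorphisms ?A ?B ?f ?g"
    using f g by (simp add: group_isomorphisms_def)
  then show ?thesis by (rule is_isoI[OF group_isomorphisms_imp_iso])
qed

section \<open>Profinite completions and homomorphisms to finite groups\<close>

text \<open>The continuous extension of \<open>f\<close> to the completion: \<open>f\<close> is
  constant on the coset that \<open>x\<close> selects modulo the kernel of \<open>f\<close>.\<close>

definition prof_ext :: "('b, 'x) monoid_scheme \<Rightarrow> ('g, 'y) monoid_scheme \<Rightarrow> ('b \<Rightarrow> 'g) \<Rightarrow> ('b set \<Rightarrow> 'b set) \<Rightarrow> 'g" where
  "prof_ext B G f x = the_elem (f ` x (kernel B G f))"

definition prof_emb :: "('a, 'x) monoid_scheme \<Rightarrow> 'a \<Rightarrow> 'a set \<Rightarrow> 'a set" where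
  "prof_emb A w = (\<lambda>N. if N \<in> fin_normals A then N #>\<^bsub>A\<^esub> w else {})"

text \<open>Restricts to \<open>A\<close> the composite of \<open>\<phi>\<close> with the continuous
  extension of \<open>f\<close>. This makes Hom into a finite group functorial in the
  completion.\<close>

definition prof_pull ::
  "('a, 'x) monoid_scheme \<Rightarrow> ('b, 'y) monoid_scheme \<Rightarrow> ('g, 'z) monoid_scheme \<Rightarrow>
   (('a set \<Rightarrow> 'a set) \<Rightarrow> ('b set \<Rightarrow> 'b set)) \<Rightarrow> ('b \<Rightarrow> 'g) \<Rightarrow> 'a \<Rightarrow> 'g" where
  "prof_pull A B G \<phi> f w = prof_ext B G f (\<phi> (prof_emb A w))"

definition prof_cont ::
  "('a, 'x) monoid_scheme \<Rightarrow> ('b, 'y) monoid_scheme \<Rightarrow> (('a set \<Rightarrow> 'a set) \<Rightarrow> ('b set \<Rightarrow> 'b set)) \<Rightarrow> bool" where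
  "prof_cont A B \<phi> \<longleftrightarrow> \<phi> \<in> hom (profinite_completion A) (profinite_completion B) \<and>
     (\<forall>N\<in>fin_normals B. \<exists>M\<in>fin_normals A. \<phi> ` prof_kernel A M \<subseteq> prof_kernel B N)"

lemma fin_normalsD:
  assumes "N \<in> fin_normals A"
  shows "N \<lhd> A" "subgroup N A" "N \<subseteq> carrier A"
  using assms by (auto simp: fin_normals_def normal_imp_subgroup subgroup.subset)

text \<open>The quotient by the kernel injects into the finite target, so kernels are among the
  indices of the completion.\<close>

lemma kernel_fin_normals:
  assumes "f \<in> hom B G" "group B" "group G" "finite (carrier G)"
  shows "kernel B G f \<in> fin_normals B"
proof -
  interpret group_hom B G f using assms by (simp add: group_hom_def group_hom_axioms_def)
  have "(\<lambda>C. the_elem (f ` C)) ` carrier (FactGroup B (kernel B G f)) \<subseteq> carrier G"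
    using FactGroup_the_elem_mem by auto
  then have "finite (carrier (FactGroup B (kernel B G f)))"
    using finite_imageD[OF finite_subset[OF _ assms(4)] FactGroup_inj_on] by blast
  then show ?thesis
    using normal_kernel by (simp add: fin_normals_def FactGroup_def)
qed

section \<open>Extending homomorphisms to the completion\<close>

context group
begin

abbreviation completion :: "('a set \<Rightarrow> 'a set) monoid" where
  "completion \<equiv> profinite_completion G"

lemma completionD:
  assumes "x \<in> carrier completion" "N \<in> fin_normals G"
  shows "\<exists>w\<in>carrier G. w \<in> x N"
    "w \<in> x N \<Longrightarrow> w \<in> carrier G \<and> x N = N #> w"
proof -
  have "x N \<in> rcosets N" using assms by (simp add: profinite_completion_def)
  then obtain u where u: "u \<in> carrier G" "x N = N #> u" by (auto simp: RCOSETS_def)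
  then show "\<exists>w\<in>carrier G. w \<in> x N"
    using rcos_self fin_normalsD[OF assms(2)] by blast
  show "w \<in> carrier G \<and> x N = N #> w" if "w \<in> x N"
    using that u repr_independence[of w N u] r_coset_subset_G[of N u] fin_normalsD[OF assms(2)] by auto
qed

lemma completion_mono:
  assumes "x \<in> carrier completion" "N \<in> fin_normals G" "M \<in> fin_normals G" "N \<subseteq> M"
  shows "x N \<subseteq> x M"
  using assms by (auto simp: profinite_completion_def)

lemma completion_mult:
  "N \<in> fin_normals G \<Longrightarrow> (x \<otimes>\<^bsub>completion\<^esub> y) N = x N <#> y N"
  by (simp add: profinite_completion_def)

lemma completion_m_closed:
  assumes x: "x \<in> carrier completion" and y: "y \<in> carrier completion"
  shows "x \<otimes>\<^bsub>completion\<^esub> y \<in> carrier completion"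
proof -
  have "(x \<otimes>\<^bsub>completion\<^esub> y) N \<in> rcosets N" if N: "N \<in> fin_normals G" for N
  proof -
    obtain u w where uw: "u \<in> carrier G" "u \<in> x N" "w \<in> carrier G" "w \<in> y N"
      using completionD(1)[OF x N] completionD(1)[OF y N] by blast
    then have "(x \<otimes>\<^bsub>completion\<^esub> y) N = N #> (u \<otimes> w)"
      using completionD(2)[OF x N uw(2)] completionD(2)[OF y N uw(4)]
        normal.rcos_sum[OF fin_normalsD(1)[OF N]] by (simp add: completion_mult[OF N])
    then show ?thesis using uw fin_normalsD(3)[OF N] by (simp add: rcosetsI)
  qed
  moreover have "(x \<otimes>\<^bsub>completion\<^esub> y) N \<subseteq> (x \<otimes>\<^bsub>completion\<^esub> y) M"
    if "N \<in> fin_normals G" "M \<in> fin_normals G" "N \<subseteq> M" for N M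
    using completion_mono[OF x that] completion_mono[OF y that]
    unfolding completion_mult[OF that(1)] completion_mult[OF that(2)] set_mult_def by blast
  moreover have "(x \<otimes>\<^bsub>completion\<^esub> y) N = {}" if "N \<notin> fin_normals G" for N
    using that by (simp add: profinite_completion_def)
  moreover have "carrier completion = {f. (\<forall>N\<in>fin_normals G. f N \<in> rcosets N)
      \<and> (\<forall>N\<in>fin_normals G. \<forall>M\<in>fin_normals G. N \<subseteq> M \<longrightarrow> f N \<subseteq> f M)
      \<and> (\<forall>N. N \<notin> fin_normals G \<longrightarrow> f N = {})}"
    by (simp add: profinite_completion_def)
  ultimately show ?thesis by simp
qed

lemma prof_emb_carrier:
  assumes "w \<in> carrier G"
  shows "prof_emb G w \<in> carrier completion"
proof -
  have "N #> w \<in> rcosets N" if "N \<in> fin_normals G" for N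
    using fin_normalsD(3)[OF that] assms by (rule rcosetsI)
  moreover have "N #> w \<subseteq> M #> w" if "N \<subseteq> M" for N M
    using that by (auto simp: r_coset_def)
  ultimately show ?thesis
    by (simp add: profinite_completion_def prof_emb_def)
qed

lemma prof_emb_mult:
  assumes "u \<in> carrier G" "w \<in> carrier G"
  shows "prof_emb G (u \<otimes> w) = prof_emb G u \<otimes>\<^bsub>completion\<^esub> prof_emb G w"
proof
  fix N
  show "prof_emb G (u \<otimes> w) N = (prof_emb G u \<otimes>\<^bsub>completion\<^esub> prof_emb G w) N"
    using normal.rcos_sum[OF fin_normalsD(1) assms, of N]
    by (simp add: profinite_completion_def prof_emb_def)
qed

text \<open>Density of the group in its completion: \<open>k\<close> is the inverse of
  \<open>w\<close> times \<open>x\<close>, and the product is checked level by level as a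
  computation with cosets.\<close>

lemma completion_decompose:
  assumes x: "x \<in> carrier completion" and N: "N \<in> fin_normals G" and w: "w \<in> x N"
  obtains k where "k \<in> prof_kernel G N" "x = prof_emb G w \<otimes>\<^bsub>completion\<^esub> k"
proof
  let ?k = "prof_emb G (inv w) \<otimes>\<^bsub>completion\<^esub> x"
  have wc: "w \<in> carrier G" and xN: "x N = N #> w" using completionD(2)[OF x N w] by auto
  have "?k N = N #> (inv w \<otimes> w)"
    using normal.rcos_sum[OF fin_normalsD(1)[OF N]] wc
    by (simp add: completion_mult[OF N] xN) (simp add: prof_emb_def N)
  then show "?k \<in> prof_kernel G N"
    using completion_m_closed[OF prof_emb_carrier x] wc fin_normalsD(3)[OF N]
    by (simp add: prof_kernel_def)
  show "x = prof_emb G w \<otimes>\<^bsub>completion\<^esub> ?k"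
  proof
    fix M
    show "x M = (prof_emb G w \<otimes>\<^bsub>completion\<^esub> ?k) M"
    proof (cases "M \<in> fin_normals G")
      case True
      obtain u where u: "u \<in> x M" using completionD(1)[OF x True] by blast
      then have uc: "u \<in> carrier G" and xM: "x M = M #> u" using completionD(2)[OF x True] by auto
      have "(prof_emb G w \<otimes>\<^bsub>completion\<^esub> ?k) M = (M #> w) <#> ((M #> inv w) <#> (M #> u))"
        by (simp add: completion_mult[OF True] xM) (simp add: prof_emb_def True)
      also have "\<dots> = M #> (w \<otimes> (inv w \<otimes> u))"
        using normal.rcos_sum[OF fin_normalsD(1)[OF True]] wc uc by simp
      also have "w \<otimes> (inv w \<otimes> u) = u" using wc uc by (simp add: m_assoc[symmetric])
      finally show ?thesis by (simp add: xM)
    next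
      case False
      then show ?thesis using x by (simp add: profinite_completion_def)
    qed
  qed
qed

text \<open>Compatibility of \<open>x\<close> carries a representative from a finer level
  \<open>N\<close> to the level of the kernel, where \<open>f\<close> is constant on the
  coset.\<close>

lemma prof_ext_eq:
  assumes f: "f \<in> hom G H" and H: "group H" "finite (carrier H)"
    and x: "x \<in> carrier completion" and N: "N \<in> fin_normals G" "N \<subseteq> kernel G H f" and w: "w \<in> x N"
  shows "prof_ext G H f x = f w"
proof -
  have K: "kernel G H f \<in> fin_normals G"
    by (rule kernel_fin_normals[OF f group_axioms H])
  have "w \<in> x (kernel G H f)" by (rule subsetD[OF completion_mono[OF x N(1) K N(2)] w])
  then have "w \<in> carrier G \<and> x (kernel G H f) = kernel G H f #> w"
    by (rule completionD(2)[OF x K])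
  moreover have "f ` (kernel G H f #> w) = {f w}" if "w \<in> carrier G"
  proof -
    have "w \<in> kernel G H f #> w" by (rule rcos_self[OF that fin_normalsD(2)[OF K]])
    moreover have "f u = f w" if u: "u \<in> kernel G H f #> w" for u
    proof -
      obtain k where k: "k \<in> kernel G H f" "u = k \<otimes> w"
        using u unfolding r_coset_def by auto
      then have "k \<in> carrier G" "f k = \<one>\<^bsub>H\<^esub>" by (simp_all add: kernel_def)
      then show ?thesis
        using hom_mult[OF f \<open>k \<in> carrier G\<close> \<open>w \<in> carrier G\<close>]
          monoid.l_one[OF group.is_monoid[OF H(1)] hom_in_carrier[OF f \<open>w \<in> carrier G\<close>]] k(2) by simp
    qed
    ultimately show ?thesis by blast
  qed
  ultimately show ?thesis by (metis prof_ext_def the_elem_eq)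
qed

lemma prof_ext_closed:
  assumes "f \<in> hom G H" "group H" "finite (carrier H)" "x \<in> carrier completion"
  shows "prof_ext G H f x \<in> carrier H"
proof -
  have K: "kernel G H f \<in> fin_normals G"
    by (rule kernel_fin_normals[OF assms(1) group_axioms assms(2,3)])
  obtain w where "w \<in> carrier G" "w \<in> x (kernel G H f)" using completionD(1)[OF assms(4) K] by blast
  then show ?thesis
    using prof_ext_eq[OF assms K order_refl] hom_in_carrier[OF assms(1)] by simp
qed

lemma prof_ext_mult:
  assumes f: "f \<in> hom G H" and H: "group H" "finite (carrier H)"
    and x: "x \<in> carrier completion" and y: "y \<in> carrier completion"
  shows "prof_ext G H f (x \<otimes>\<^bsub>completion\<^esub> y) = prof_ext G H f x \<otimes>\<^bsub>H\<^esub> prof_ext G H f y"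
proof -
  let ?K = "kernel G H f"
  have K: "?K \<in> fin_normals G" by (rule kernel_fin_normals[OF f group_axioms H])
  obtain u w where uw: "u \<in> carrier G" "u \<in> x ?K" "w \<in> carrier G" "w \<in> y ?K"
    using completionD(1)[OF x K] completionD(1)[OF y K] by blast
  then have "u \<otimes> w \<in> (x \<otimes>\<^bsub>completion\<^esub> y) ?K"
    by (auto simp: completion_mult[OF K] set_mult_def)
  then show ?thesis
    using prof_ext_eq[OF f H completion_m_closed[OF x y] K order_refl, of "u \<otimes> w"]
      prof_ext_eq[OF f H x K order_refl uw(2)] prof_ext_eq[OF f H y K order_refl uw(4)]
      hom_mult[OF f uw(1,3)] by simp
qed

lemma prof_ext_emb:
  assumes f: "f \<in> hom G H" and H: "group H" "finite (carrier H)" and w: "w \<in> carrier G"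
  shows "prof_ext G H f (prof_emb G w) = f w"
proof (rule prof_ext_eq[OF f H prof_emb_carrier[OF w]])
  show K: "kernel G H f \<in> fin_normals G" by (rule kernel_fin_normals[OF f group_axioms H])
  show "w \<in> prof_emb G w (kernel G H f)"
    using rcos_self[OF w fin_normalsD(2)[OF K]] by (simp add: prof_emb_def K)
qed simp

lemma prof_ext_prof_kernel:
  assumes f: "f \<in> hom G H" and H: "group H" "finite (carrier H)"
    and k: "k \<in> prof_kernel G (kernel G H f)"
  shows "prof_ext G H f k = \<one>\<^bsub>H\<^esub>"
proof -
  have K: "kernel G H f \<in> fin_normals G" by (rule kernel_fin_normals[OF f group_axioms H])
  have "\<one> \<in> k (kernel G H f)"
    using k subgroup.one_closed[OF fin_normalsD(2)[OF K]] by (simp add: prof_kernel_def)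
  then show ?thesis
    using k prof_ext_eq[OF f H _ K order_refl, of k \<one>] hom_one[OF f group_axioms H(1)]
    by (simp add: prof_kernel_def)
qed

text \<open>The kernel of \<open>f\<close> lies in that of \<open>g\<close>, so one representative
  modulo the former computes both extensions.\<close>

lemma prof_ext_comp:
  assumes f: "f \<in> hom G H" and H: "group H" "finite (carrier H)"
    and h: "h \<in> hom H H'" and H': "group H'" "finite (carrier H')"
    and g: "g \<in> hom G H'" and eq: "\<And>w. w \<in> carrier G \<Longrightarrow> g w = h (f w)"
    and x: "x \<in> carrier completion"
  shows "prof_ext G H' g x = h (prof_ext G H f x)"
proof -
  have K: "kernel G H f \<in> fin_normals G" by (rule kernel_fin_normals[OF f group_axioms H])
  have "kernel G H f \<subseteq> kernel G H' g"
    using eq hom_one[OF h H(1) H'(1)] by (auto simp: kernel_def)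
  moreover obtain w where w: "w \<in> carrier G" "w \<in> x (kernel G H f)" using completionD(1)[OF x K] by blast
  ultimately show ?thesis
    using prof_ext_eq[OF g H' x K _ w(2)] prof_ext_eq[OF f H x K order_refl w(2)] eq by simp
qed

end

lemma prof_emb_kernel:
  assumes "group A" "M \<in> fin_normals A" "w \<in> M"
  shows "prof_emb A w \<in> prof_kernel A M"
  using assms group.prof_emb_carrier[OF assms(1), of w] fin_normalsD[OF assms(2)]
    subgroup.rcos_const[of M A w]
  by (auto simp: prof_kernel_def prof_emb_def)

section \<open>Pulling homomorphisms back along a map of completions\<close>

lemma prof_pull_hom:
  assumes A: "group A" and B: "group B" and \<phi>: "prof_cont A B \<phi>"
    and f: "f \<in> hom B G" and G: "group G" "finite (carrier G)"
  shows "prof_pull A B G \<phi> f \<in> hom A G"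
proof -
  have hom: "\<phi> \<in> hom (profinite_completion A) (profinite_completion B)"
    using \<phi> by (simp add: prof_cont_def)
  note emb = group.prof_emb_carrier[OF A]
  show ?thesis
    using group.prof_ext_closed[OF B f G] hom_in_carrier[OF hom emb]
      group.prof_ext_mult[OF B f G] hom_mult[OF hom emb emb]
    by (intro homI) (simp_all add: prof_pull_def group.prof_emb_mult[OF A])
qed

lemma prof_pull_comp:
  assumes A: "group A" and B: "group B" and \<phi>: "prof_cont A B \<phi>"
    and f: "f \<in> hom B G" and G: "group G" "finite (carrier G)"
    and h: "h \<in> hom G H" and H: "group H" "finite (carrier H)"
    and g: "g \<in> hom B H" and eq: "\<And>w. w \<in> carrier B \<Longrightarrow> g w = h (f w)"
    and w: "w \<in> carrier A"
  shows "prof_pull A B H \<phi> g w = h (prof_pull A B G \<phi> f w)"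
proof -
  have hom: "\<phi> \<in> hom (profinite_completion A) (profinite_completion B)"
    using \<phi> by (simp add: prof_cont_def)
  show ?thesis
    unfolding prof_pull_def
    by (rule group.prof_ext_comp[OF B f G h H g eq])
      (use hom_in_carrier[OF hom group.prof_emb_carrier[OF A w]] in auto)
qed

text \<open>This is where continuity acts: it gives a level \<open>M\<close> whose kernel
  \<open>\<phi>\<close> sends into the kernel of the extension of \<open>f\<close>. By density
  \<open>x\<close> is an element of \<open>A\<close> times something in that kernel, and on
  \<open>A\<close> both sides agree by definition.\<close>

lemma prof_ext_pull:
  assumes A: "group A" and B: "group B" and \<phi>: "prof_cont A B \<phi>"
    and f: "f \<in> hom B G" and G: "group G" "finite (carrier G)"
    and x: "x \<in> carrier (profinite_completion A)"
  shows "prof_ext A G (prof_pull A B G \<phi> f) x = prof_ext B G f (\<phi> x)"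
proof -
  let ?g = "prof_pull A B G \<phi> f"
  have hom: "\<phi> \<in> hom (profinite_completion A) (profinite_completion B)"
    using \<phi> by (simp add: prof_cont_def)
  have g: "?g \<in> hom A G" by (rule prof_pull_hom[OF A B \<phi> f G])
  have "kernel B G f \<in> fin_normals B" by (rule kernel_fin_normals[OF f B G])
  then obtain M where M: "M \<in> fin_normals A" "\<phi> ` prof_kernel A M \<subseteq> prof_kernel B (kernel B G f)"
    using \<phi> by (auto simp: prof_cont_def)
  have one: "prof_ext B G f (\<phi> k) = \<one>\<^bsub>G\<^esub>" if "k \<in> prof_kernel A M" for k
    using group.prof_ext_prof_kernel[OF B f G] M(2) that by blast
  have "M \<subseteq> kernel A G ?g"
    using one prof_emb_kernel[OF A M(1)] fin_normalsD(3)[OF M(1)]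
    by (auto simp: kernel_def prof_pull_def)
  moreover obtain w where w: "w \<in> carrier A" "w \<in> x M" using group.completionD(1)[OF A x M(1)] by blast
  ultimately have 1: "prof_ext A G ?g x = ?g w"
    by (intro group.prof_ext_eq[OF A g G x M(1)])
  obtain k where k: "k \<in> prof_kernel A M" "x = prof_emb A w \<otimes>\<^bsub>profinite_completion A\<^esub> k"
    by (rule group.completion_decompose[OF A x M(1) w(2)])
  have kc: "k \<in> carrier (profinite_completion A)" using k by (simp add: prof_kernel_def)
  note emb = group.prof_emb_carrier[OF A w(1)]
  have "prof_ext B G f (\<phi> x) = ?g w \<otimes>\<^bsub>G\<^esub> prof_ext B G f (\<phi> k)"
    using group.prof_ext_mult[OF B f G hom_in_carrier[OF hom emb] hom_in_carrier[OF hom kc]]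
    by (simp add: k(2) hom_mult[OF hom emb kc] prof_pull_def)
  also have "\<dots> = ?g w"
    using one[OF k(1)] hom_in_carrier[OF g w(1)] G(1) by (simp add: group.is_monoid)
  finally show ?thesis using 1 by simp
qed

text \<open>By \<open>prof_ext_pull\<close> the inner pullback extends to \<open>f\<close> after
  \<open>\<phi>\<close>, so that \<open>\<phi>\<close> meets \<open>\<psi>\<close> and both
  cancel.\<close>

lemma prof_pull_inverse:
  assumes A: "group A" and B: "group B" and \<phi>: "prof_cont A B \<phi>" and \<psi>: "prof_cont B A \<psi>"
    and inv: "\<And>y. y \<in> carrier (profinite_completion B) \<Longrightarrow> \<phi> (\<psi> y) = y"
    and f: "f \<in> hom B G" and G: "group G" "finite (carrier G)" and b: "b \<in> carrier B"
  shows "prof_pull B A G \<psi> (prof_pull A B G \<phi> f) b = f b"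
proof -
  have hom: "\<psi> \<in> hom (profinite_completion B) (profinite_completion A)"
    using \<psi> by (simp add: prof_cont_def)
  note emb = group.prof_emb_carrier[OF B b]
  show ?thesis
    using prof_ext_pull[OF A B \<phi> f G hom_in_carrier[OF hom emb]] inv[OF emb]
      group.prof_ext_emb[OF B f G b]
    by (simp add: prof_pull_def[of B])
qed

text \<open>Functions agreeing on the carrier may differ elsewhere, so this is not a rewriting by
  equality; it is naturality for the identity of \<open>G\<close>.\<close>

lemma prof_pull_cong:
  assumes A: "group A" and B: "group B" and \<phi>: "prof_cont A B \<phi>"
    and f: "f \<in> hom B G" and G: "group G" "finite (carrier G)"
    and g: "g \<in> hom B G" and eq: "\<And>w. w \<in> carrier B \<Longrightarrow> g w = f w"
    and w: "w \<in> carrier A"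
  shows "prof_pull A B G \<phi> g w = prof_pull A B G \<phi> f w"
  using prof_pull_comp[OF A B \<phi> f G _ G g _ w, of "\<lambda>x. x"] eq by (simp add: hom_def)

text \<open>The second continuity clause of \<open>profinite_iso\<close>, read through the inverse
  map, is continuity of that inverse.\<close>

lemma profinite_isoE:
  assumes "group A" "group B" "profinite_iso A B"
  obtains \<phi> \<psi> where "prof_cont A B \<phi>" "prof_cont B A \<psi>"
    "\<And>x. x \<in> carrier (profinite_completion A) \<Longrightarrow> \<psi> (\<phi> x) = x"
    "\<And>y. y \<in> carrier (profinite_completion B) \<Longrightarrow> \<phi> (\<psi> y) = y"
proof -
  let ?A = "profinite_completion A" and ?B = "profinite_completion B"
  obtain \<phi> where iso: "\<phi> \<in> iso ?A ?B"
    and c1: "\<forall>N\<in>fin_normals B. \<exists>M\<in>fin_normals A. \<phi> ` prof_kernel A M \<subseteq> prof_kernel B N"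
    and c2: "\<forall>M\<in>fin_normals A. \<exists>N\<in>fin_normals B. \<forall>x\<in>carrier ?A. \<phi> x \<in> prof_kernel B N \<longrightarrow> x \<in> prof_kernel A M"
    using assms(3) by (auto simp: profinite_iso_def)
  have hom: "\<phi> \<in> hom ?A ?B" and bij: "bij_betw \<phi> (carrier ?A) (carrier ?B)"
    using iso by (auto simp: iso_def)
  define \<psi> where "\<psi> = inv_into (carrier ?A) \<phi>"
  have \<psi>: "\<psi> y \<in> carrier ?A" "\<phi> (\<psi> y) = y" if "y \<in> carrier ?B" for y
    using that bij by (auto simp: \<psi>_def bij_betw_def inv_into_into f_inv_into_f)
  have \<psi>\<phi>: "\<psi> (\<phi> x) = x" if "x \<in> carrier ?A" for x
    using that bij by (auto simp: \<psi>_def bij_betw_def)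
  have "\<psi> \<in> hom ?B ?A"
  proof (rule homI)
    fix x y assume xy: "x \<in> carrier ?B" "y \<in> carrier ?B"
    then have "\<phi> (\<psi> x \<otimes>\<^bsub>?A\<^esub> \<psi> y) = x \<otimes>\<^bsub>?B\<^esub> y"
      using hom_mult[OF hom] \<psi> by simp
    then show "\<psi> (x \<otimes>\<^bsub>?B\<^esub> y) = \<psi> x \<otimes>\<^bsub>?A\<^esub> \<psi> y"
      using \<psi>\<phi> group.completion_m_closed[OF assms(1)] \<psi> xy by metis
  qed (use \<psi> in auto)
  moreover have "\<exists>N\<in>fin_normals B. \<psi> ` prof_kernel B N \<subseteq> prof_kernel A M" if M: "M \<in> fin_normals A" for M
  proof -
    obtain N where N: "N \<in> fin_normals B" "\<forall>x\<in>carrier ?A. \<phi> x \<in> prof_kernel B N \<longrightarrow> x \<in> prof_kernel A M"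
      using c2 M by blast
    have "\<psi> y \<in> prof_kernel A M" if "y \<in> prof_kernel B N" for y
      using N(2) \<psi>[of y] that by (auto simp: prof_kernel_def)
    then show ?thesis using N(1) by blast
  qed
  ultimately have "prof_cont B A \<psi>" by (simp add: prof_cont_def)
  moreover have "prof_cont A B \<phi>" using hom c1 by (simp add: prof_cont_def)
  ultimately show ?thesis using that \<psi>\<phi> \<psi>(2) by blast
qed

section \<open>Transfer of homomorphisms along the isomorphism of completions\<close>

text \<open>\<open>W\<close> stays an arbitrary group; \<open>\<iota>\<close> and
  \<open>\<kappa>\<close> identify it with the Coxeter group of the second graph, so that
  homomorphisms out of it are given by functions on \<open>V'\<close>.\<close>

locale cox_transfer =
  fixes V :: "'v set" and E :: "'v set set" and m :: "'v set \<Rightarrow> nat"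
    and V' :: "'u set" and E' :: "'u set set" and m' :: "'u set \<Rightarrow> nat"
    and W :: "('w, 'z) monoid_scheme"
    and \<phi> :: "('w set \<Rightarrow> 'w set) \<Rightarrow> 'v list set set \<Rightarrow> 'v list set set"
    and \<psi> :: "('v list set set \<Rightarrow> 'v list set set) \<Rightarrow> 'w set \<Rightarrow> 'w set"
    and \<iota> :: "'u list set \<Rightarrow> 'w" and \<kappa> :: "'w \<Rightarrow> 'u list set"
  assumes graph: "coxeter_graph V E m" and div4: "\<And>e. e \<in> E \<Longrightarrow> 4 dvd m e"
    and graph': "coxeter_graph V' E' m'" and W: "group W"
    and \<iota>: "\<iota> \<in> hom (coxeter_group V' E' m') W" and \<kappa>: "\<kappa> \<in> hom W (coxeter_group V' E' m')"
    and \<iota>\<kappa>: "\<And>w. w \<in> carrier W \<Longrightarrow> \<iota> (\<kappa> w) = w"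
    and \<kappa>\<iota>: "\<And>A. A \<in> carrier (coxeter_group V' E' m') \<Longrightarrow> \<kappa> (\<iota> A) = A"
    and \<phi>: "prof_cont W (coxeter_group V E m) \<phi>"
    and \<psi>: "prof_cont (coxeter_group V E m) W \<psi>"
    and \<psi>\<phi>: "\<And>x. x \<in> carrier (profinite_completion W) \<Longrightarrow> \<psi> (\<phi> x) = x"
    and \<phi>\<psi>: "\<And>y. y \<in> carrier (profinite_completion (coxeter_group V E m)) \<Longrightarrow> \<phi> (\<psi> y) = y"
begin

abbreviation "\<Gamma> \<equiv> coxeter_group V E m"
abbreviation "\<Gamma>' \<equiv> coxeter_group V' E' m'"

lemma finite_V: "finite V" and finite_V': "finite V'"
  using graph graph' by (auto simp: coxeter_graph_def)

text \<open>The map of Hom sets induced by \<open>\<phi>\<close>, in generator coordinates.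
  \<open>tr G s a\<close> depends on all of \<open>s\<close> and need not be one of its
  values.\<close>

definition tr :: "('g, 'y) monoid_scheme \<Rightarrow> ('v \<Rightarrow> 'g) \<Rightarrow> 'u \<Rightarrow> 'g" where
  "tr G s = (\<lambda>a\<in>V'. prof_pull W \<Gamma> G \<phi> (cox_lift G s) (\<iota> (cox_class V' E' m' [a])))"

definition tr_inv :: "('g, 'y) monoid_scheme \<Rightarrow> ('u \<Rightarrow> 'g) \<Rightarrow> 'v \<Rightarrow> 'g" where
  "tr_inv G t = (\<lambda>x\<in>V. prof_pull \<Gamma> W G \<psi> (cox_lift G t \<circ> \<kappa>) (cox_class V E m [x]))"

lemma gen_carrier [simp]: "x \<in> V \<Longrightarrow> cox_class V E m [x] \<in> carrier \<Gamma>"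
  and gen_carrier' [simp]: "a \<in> V' \<Longrightarrow> cox_class V' E' m' [a] \<in> carrier \<Gamma>'"
  by (auto simp: carrier_coxeter_group)

context
  fixes G :: "('g, 'y) monoid_scheme"
  assumes G: "group G" "finite (carrier G)"
begin

lemma pull_hom:
  assumes "s \<in> cox_maps V E m G"
  shows "prof_pull W \<Gamma> G \<phi> (cox_lift G s) \<in> hom W G"
  by (rule prof_pull_hom[OF W group_coxeter_group \<phi> group.cox_lift_hom[OF G(1) assms] G])

lemma pull_inv_hom:
  assumes "t \<in> cox_maps V' E' m' G"
  shows "prof_pull \<Gamma> W G \<psi> (cox_lift G t \<circ> \<kappa>) \<in> hom \<Gamma> G"
  by (rule prof_pull_hom[OF group_coxeter_group W \<psi> hom_compose[OF \<kappa> group.cox_lift_hom[OF G(1) assms]] G])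

lemma tr_maps:
  assumes "s \<in> cox_maps V E m G"
  shows "tr G s \<in> cox_maps V' E' m' G"
  using hom_gens_cox_maps[OF hom_compose[OF \<iota> pull_hom[OF assms]] G(1)] by (simp add: tr_def)

lemma tr_inv_maps:
  assumes "t \<in> cox_maps V' E' m' G"
  shows "tr_inv G t \<in> cox_maps V E m G"
  using hom_gens_cox_maps[OF pull_inv_hom[OF assms] G(1)] by (simp add: tr_inv_def)

lemma lift_tr:
  assumes s: "s \<in> cox_maps V E m G" and w: "w \<in> carrier W"
  shows "(cox_lift G (tr G s) \<circ> \<kappa>) w = prof_pull W \<Gamma> G \<phi> (cox_lift G s) w"
proof -
  have "cox_lift G (tr G s) (\<kappa> w) = (prof_pull W \<Gamma> G \<phi> (cox_lift G s) \<circ> \<iota>) (\<kappa> w)"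
    by (rule hom_eq_on_gens[OF group.cox_lift_hom[OF G(1) tr_maps[OF s]]
        hom_compose[OF \<iota> pull_hom[OF s]] G(1) _ hom_in_carrier[OF \<kappa> w]])
      (simp add: group.cox_lift_gen[OF G(1) tr_maps[OF s]], simp add: tr_def)
  then show ?thesis using \<iota>\<kappa>[OF w] by simp
qed

lemma lift_tr_inv:
  assumes t: "t \<in> cox_maps V' E' m' G" and w: "w \<in> carrier \<Gamma>"
  shows "cox_lift G (tr_inv G t) w = prof_pull \<Gamma> W G \<psi> (cox_lift G t \<circ> \<kappa>) w"
  by (rule hom_eq_on_gens[OF group.cox_lift_hom[OF G(1) tr_inv_maps[OF t]] pull_inv_hom[OF t] G(1) _ w])
    (simp add: group.cox_lift_gen[OF G(1) tr_inv_maps[OF t]], simp add: tr_inv_def)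

lemma tr_inv_tr:
  assumes s: "s \<in> cox_maps V E m G"
  shows "tr_inv G (tr G s) = s"
proof (rule cox_maps_ext[OF tr_inv_maps[OF tr_maps[OF s]] s])
  fix x assume x: "x \<in> V"
  note lift = group.cox_lift_hom[OF G(1) s]
  have "tr_inv G (tr G s) x = prof_pull \<Gamma> W G \<psi> (cox_lift G (tr G s) \<circ> \<kappa>) (cox_class V E m [x])"
    using x by (simp add: tr_inv_def)
  also have "\<dots> = prof_pull \<Gamma> W G \<psi> (prof_pull W \<Gamma> G \<phi> (cox_lift G s)) (cox_class V E m [x])"
    by (rule prof_pull_cong[OF group_coxeter_group W \<psi> pull_hom[OF s] G
        hom_compose[OF \<kappa> group.cox_lift_hom[OF G(1) tr_maps[OF s]]] lift_tr[OF s] gen_carrier[OF x]])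
  also have "\<dots> = s x"
    using prof_pull_inverse[OF W group_coxeter_group \<phi> \<psi> \<phi>\<psi> lift G] x
      group.cox_lift_gen[OF G(1) s x] by simp
  finally show "tr_inv G (tr G s) x = s x" .
qed

lemma tr_tr_inv:
  assumes t: "t \<in> cox_maps V' E' m' G"
  shows "tr G (tr_inv G t) = t"
proof (rule cox_maps_ext[OF tr_maps[OF tr_inv_maps[OF t]] t])
  fix a assume a: "a \<in> V'"
  let ?w = "\<iota> (cox_class V' E' m' [a])"
  have w: "?w \<in> carrier W" using hom_in_carrier[OF \<iota>] a by simp
  note lift = hom_compose[OF \<kappa> group.cox_lift_hom[OF G(1) t]]
  have "tr G (tr_inv G t) a = prof_pull W \<Gamma> G \<phi> (cox_lift G (tr_inv G t)) ?w"
    using a by (simp add: tr_def)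
  also have "\<dots> = prof_pull W \<Gamma> G \<phi> (prof_pull \<Gamma> W G \<psi> (cox_lift G t \<circ> \<kappa>)) ?w"
    by (rule prof_pull_cong[OF W group_coxeter_group \<phi> pull_inv_hom[OF t] G
        group.cox_lift_hom[OF G(1) tr_inv_maps[OF t]] lift_tr_inv[OF t] w])
  also have "\<dots> = (cox_lift G t \<circ> \<kappa>) ?w"
    by (rule prof_pull_inverse[OF group_coxeter_group W \<psi> \<phi> \<psi>\<phi> lift G w])
  also have "\<dots> = t a"
    using \<kappa>\<iota> a group.cox_lift_gen[OF G(1) t a] by simp
  finally show "tr G (tr_inv G t) a = t a" .
qed

lemma bij_tr: "bij_betw (tr G) (cox_maps V E m G) (cox_maps V' E' m' G)"
  by (rule bij_betw_byWitness[of _ "tr_inv G"])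
    (auto simp: tr_inv_tr tr_tr_inv tr_maps tr_inv_maps)

end

text \<open>The main tool for computing with \<open>tr\<close>: a transferred value in a dihedral
  group is read off from its images under characters and reductions.\<close>

lemma tr_nat:
  assumes G: "group G" "finite (carrier G)" and H: "group H" "finite (carrier H)"
    and s: "s \<in> cox_maps V E m G" and h: "h \<in> hom G H" and a: "a \<in> V'"
  shows "tr H (\<lambda>x\<in>V. h (s x)) a = h (tr G s a)"
proof -
  have hs: "(\<lambda>x\<in>V. h (s x)) \<in> cox_maps V E m H" by (rule cox_maps_comp[OF s h G(1) H(1)])
  have "cox_lift H (\<lambda>x\<in>V. h (s x)) A = (h \<circ> cox_lift G s) A" if "A \<in> carrier \<Gamma>" for A
    by (rule hom_eq_on_gens[OF group.cox_lift_hom[OF H(1) hs]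
          hom_compose[OF group.cox_lift_hom[OF G(1) s] h] H(1) _ that])
      (simp add: group.cox_lift_gen[OF H(1) hs] group.cox_lift_gen[OF G(1) s])
  then show ?thesis
    using prof_pull_comp[OF W group_coxeter_group \<phi> group.cox_lift_hom[OF G(1) s] G h H
        group.cox_lift_hom[OF H(1) hs]] hom_in_carrier[OF \<iota>] a
    by (simp add: tr_def)
qed

lemma cox_maps_subgroup:
  assumes "subgroup K G" "group G"
  shows "s \<in> cox_maps U F l (G\<lparr>carrier := K\<rparr>) \<longleftrightarrow> s \<in> cox_maps U F l G \<and> s ` U \<subseteq> K"
proof -
  have "K \<subseteq> carrier G" using assms(1) by (rule subgroup.subset)
  moreover have "x [^]\<^bsub>G\<lparr>carrier := K\<rparr>\<^esub> n = x [^]\<^bsub>G\<^esub> n" for x and n :: nat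
    by (simp add: nat_pow_def)
  ultimately show ?thesis
    by (auto simp: cox_maps_def PiE_iff)
qed

text \<open>A homomorphism with image in \<open>K\<close> is a homomorphism into \<open>K\<close>,
  and \<open>tr\<close> is natural for the inclusion. The converse combines surjectivity of
  \<open>tr\<close> for \<open>K\<close> with its injectivity for \<open>G\<close>.\<close>

lemma tr_image_subset_iff:
  assumes G: "group G" "finite (carrier G)" and s: "s \<in> cox_maps V E m G" and K: "subgroup K G"
  shows "tr G s ` V' \<subseteq> K \<longleftrightarrow> s ` V \<subseteq> K"
proof -
  let ?K = "G\<lparr>carrier := K\<rparr>"
  have K': "group ?K" "finite (carrier ?K)"
    using K G finite_subset[OF subgroup.subset[OF K]] by (auto intro: subgroup.subgroup_is_group)
  have id: "(\<lambda>g. g) \<in> hom ?K G"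
    using subgroup.subset[OF K] by (auto simp: hom_def)
  have eq: "tr G r = tr ?K r" if r: "r \<in> cox_maps V E m ?K" for r
  proof (rule cox_maps_ext[of _ V' E' m' G])
    have "r \<in> cox_maps V E m G" using r cox_maps_subgroup[OF K G(1)] by blast
    then show "tr G r \<in> cox_maps V' E' m' G" by (rule tr_maps[OF G])
    show "tr ?K r \<in> cox_maps V' E' m' G"
      using tr_maps[OF K' r] cox_maps_subgroup[OF K G(1)] by blast
    have "restrict r V = r" using cox_mapsD(1)[OF r] by (simp add: PiE_def extensional_restrict)
    then show "tr G r a = tr ?K r a" if "a \<in> V'" for a
      using tr_nat[OF K' G r id that] by simp
  qed
  show ?thesis
  proof
    assume "s ` V \<subseteq> K"
    then have "s \<in> cox_maps V E m ?K" using s cox_maps_subgroup[OF K G(1)] by blast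
    then show "tr G s ` V' \<subseteq> K"
      using eq tr_maps[OF K'] cox_maps_subgroup[OF K G(1)] by metis
  next
    assume "tr G s ` V' \<subseteq> K"
    then have "tr G s \<in> cox_maps V' E' m' ?K"
      using tr_maps[OF G s] cox_maps_subgroup[OF K G(1)] by blast
    then obtain r where r: "r \<in> cox_maps V E m ?K" "tr ?K r = tr G s"
      using tr_tr_inv[OF K'] tr_inv_maps[OF K'] by metis
    have r': "r \<in> cox_maps V E m G \<and> r ` V \<subseteq> K"
      using r(1) by (simp only: cox_maps_subgroup[OF K G(1)])
    have "tr G r = tr G s" using eq[OF r(1)] r(2) by simp
    then have "r = s" using tr_inv_tr[OF G s] tr_inv_tr[OF G conjunct1[OF r']] by simp
    then show "s ` V \<subseteq> K" using r' by simp
  qed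
qed

end

section \<open>Separating the ends of an edge with odd label\<close>

text \<open>In characteristic 2 reflections become transvections, and roots of unity of any odd order exist.\<close>

type_synonym k2 = "bit alg_closure"

lemma k2_add_self [simp]: "(x :: k2) + x = 0"
proof -
  have "to_ac (1 :: bit) + to_ac 1 = (0 :: k2)"
    unfolding to_ac_add[symmetric] by simp
  then have "(1 + 1 :: k2) = 0" by simp
  then have "x * (1 + 1) = 0" by simp
  then show ?thesis by (simp only: distrib_left mult_1_right)
qed

lemma k2_add_self_left [simp]: "(x :: k2) + (x + y) = y"
  by (simp add: add.assoc[symmetric])

lemma k2_add_eq_0_iff: "(x :: k2) + y = 0 \<longleftrightarrow> x = y"
  using k2_add_self_left[of x y] k2_add_self[of x] by (metis add_0_right)

lemma k2_frobenius: "((x :: k2) + y) ^ 2 ^ k = x ^ 2 ^ k + y ^ 2 ^ k"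
proof (induction k)
  case (Suc k)
  have sq: "(u + v) ^ 2 = u ^ 2 + v ^ 2" for u v :: k2
    by (simp add: power2_eq_square algebra_simps)
  have "(x + y) ^ 2 ^ Suc k = ((x + y) ^ 2 ^ k) ^ 2"
    by (simp add: power_mult[symmetric] mult.commute)
  also have "\<dots> = (x ^ 2 ^ k) ^ 2 + (y ^ 2 ^ k) ^ 2" by (simp add: Suc sq)
  finally show ?case by (simp add: power_mult[symmetric] mult.commute)
qed simp

text \<open>Take a root of 1 + X + ... + X^(n-1). At 1 this polynomial has the value n, which is 1
  in characteristic 2 for odd n, so the root is not 1.\<close>

lemma k2_root_of_unity:
  assumes "odd n" "n > 1"
  shows "\<exists>\<zeta>::k2. \<zeta> ^ n = 1 \<and> \<zeta> \<noteq> 1"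
proof -
  obtain j where n: "n = Suc (2 * j)" using assms(1) by (elim oddE) simp
  obtain \<zeta> :: k2 where z: "(\<Sum>k\<le>n - 1. 1 * \<zeta> ^ k) = 0"
    using alg_closed[of "n - 1" "\<lambda>_. 1 :: k2"] assms by auto
  have "\<zeta> ^ n - 1 = (\<zeta> - 1) * (\<Sum>k<n. \<zeta> ^ k)" by (rule power_diff_1_eq)
  also have "{..<n} = {..n - 1}" using assms by auto
  finally have "\<zeta> ^ n = 1" using z by simp
  moreover have "(of_nat n :: k2) = 1"
    by (simp add: n mult_2)
  then have "\<zeta> \<noteq> 1" using z assms by (auto simp: of_nat_diff)
  ultimately show ?thesis by blast
qed

lemma finite_k2_fixed:
  assumes "k > 0"
  shows "finite {x :: k2. x ^ 2 ^ k = x}"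
proof -
  let ?p = "monom 1 (2 ^ k) - monom 1 1 :: k2 poly"
  have "(2::nat) ^ k > 1" using assms by (rule one_less_power[rotated]) simp
  then have "coeff ?p (2 ^ k) = 1" by simp
  then have "?p \<noteq> 0" by (metis coeff_0 zero_neq_one)
  then have "finite {x. poly ?p x = 0}" by (rule poly_roots_finite)
  then show ?thesis by (simp add: poly_monom)
qed

text \<open>The dual of the geometric representation: \<open>f\<close> is a functional given by its
  values on the simple roots, and \<open>c v w\<close> replaces 2 cos(pi/m). The diagonal entry -2
  of a reflection becomes 0 in characteristic 2.\<close>

definition transv :: "('u \<Rightarrow> 'u \<Rightarrow> k2) \<Rightarrow> 'u \<Rightarrow> ('u \<Rightarrow> k2) \<Rightarrow> 'u \<Rightarrow> k2" where
  "transv c v f = (\<lambda>w. f w + c v w * f v)"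

lemma transv_transv:
  assumes "c v v = 0"
  shows "transv c v (transv c v f) = f"
  by (rule ext) (simp add: transv_def assms add.assoc)

lemma transv_pow_even:
  assumes "c v v = 0" "c w w = 0" "c v w = 0" "c w v = 0" "even n"
  shows "((transv c v \<circ> transv c w) ^^ n) f = f"
proof -
  have 2: "(transv c v \<circ> transv c w) ((transv c v \<circ> transv c w) f) = f" for f
    by (rule ext) (simp add: transv_def assms algebra_simps)
  have "((transv c v \<circ> transv c w) ^^ (2 * k)) f = f" for k
  proof (induction k)
    case (Suc k)
    then show ?case using 2[of f] by simp
  qed simp
  then show ?thesis using assms(5) by (auto elim: evenE)
qed

text \<open>Writing \<open>x, y, z\<close> for the values of a function at \<open>v, w, u\<close>, the product of the two
  transvections multiplies \<open>x + \<zeta> y\<close> and \<open>x + y / \<zeta>\<close> by \<open>\<zeta>\<^sup>2\<close> and \<open>1 / \<zeta>\<^sup>2\<close>,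
  and it fixes \<open>z + (c w u * x + c v u * y) / c v w\<close>.\<close>

lemma transv_pow_odd:
  assumes c: "c v v = 0" "c w w = 0" "c v w = \<zeta> + inverse \<zeta>" "c w v = \<zeta> + inverse \<zeta>"
    and z: "\<zeta> ^ n = 1" "\<zeta> \<noteq> 1" "n > 0"
  shows "((transv c v \<circ> transv c w) ^^ n) f = f"
proof -
  define T where "T = transv c v \<circ> transv c w"
  define d where "d = \<zeta> + inverse \<zeta>"
  have z0: "\<zeta> \<noteq> 0" using z by (auto simp: power_0_left)
  \<comment> \<open>If \<open>d\<close> vanished, \<open>\<zeta>\<close> would be its own inverse,
    and in characteristic 2 the only square root of 1 is 1.\<close>
  have d0: "d \<noteq> 0"
  proof
    assume "d = 0"
    then have "\<zeta> = inverse \<zeta>" by (simp add: d_def k2_add_eq_0_iff)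
    then have "\<zeta> * \<zeta> = 1" using z0 by (metis right_inverse)
    then have "(\<zeta> + 1) * (\<zeta> + 1) = 0" by (simp add: algebra_simps)
    then show False using z(2) by (simp add: k2_add_eq_0_iff)
  qed
  have zd: "\<zeta> * d = \<zeta> * \<zeta> + 1" "inverse \<zeta> * d = 1 + inverse \<zeta> * inverse \<zeta>"
    using z0 by (simp_all add: d_def algebra_simps)
  define P where "P f = f v + \<zeta> * f w" for f :: "'a \<Rightarrow> k2"
  define Q where "Q f = f v + inverse \<zeta> * f w" for f :: "'a \<Rightarrow> k2"
  define I where "I u f = d * f u + c w u * f v + c v u * f w" for u and f :: "'a \<Rightarrow> k2"
  have Tv: "T f v = f v + d * f w" and Tw: "T f w = f w + d * (f v + d * f w)"
    and Tu: "T f u = f u + c w u * f w + c v u * (f v + d * f w)" for f u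
    using c by (simp_all add: T_def transv_def d_def)
  have P: "P (T f) = \<zeta> * \<zeta> * P f" for f
  proof -
    have "P (T f) = (1 + \<zeta> * d) * f v + (d + \<zeta> + (\<zeta> * d) * d) * f w"
      unfolding P_def Tv Tw by (simp add: algebra_simps)
    also have "\<dots> = \<zeta> * \<zeta> * f v + (\<zeta> + \<zeta> * \<zeta> * d) * f w"
      unfolding zd(1) by (simp add: algebra_simps)
    also have "\<zeta> * \<zeta> * d = \<zeta> * \<zeta> * \<zeta> + \<zeta>"
      unfolding mult.assoc zd(1) by (simp add: algebra_simps)
    also have "\<zeta> * \<zeta> * f v + (\<zeta> + (\<zeta> * \<zeta> * \<zeta> + \<zeta>)) * f w = \<zeta> * \<zeta> * P f"
      by (simp add: P_def algebra_simps)
    finally show ?thesis .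
  qed
  have Q: "Q (T f) = inverse \<zeta> * inverse \<zeta> * Q f" for f
  proof -
    let ?y = "inverse \<zeta>"
    have "Q (T f) = (1 + ?y * d) * f v + (d + ?y + (?y * d) * d) * f w"
      unfolding Q_def Tv Tw by (simp add: algebra_simps)
    also have "\<dots> = ?y * ?y * f v + (?y + ?y * ?y * d) * f w"
      unfolding zd(2) by (simp add: algebra_simps)
    also have "?y * ?y * d = ?y + ?y * ?y * ?y"
      unfolding mult.assoc zd(2) by (simp add: algebra_simps)
    also have "?y * ?y * f v + (?y + (?y + ?y * ?y * ?y)) * f w = ?y * ?y * Q f"
      by (simp add: Q_def algebra_simps)
    finally show ?thesis .
  qed
  have I: "I u (T f) = I u f" for u f
    unfolding I_def Tv Tw unfolding Tu by (simp add: algebra_simps)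
  have iter: "P ((T ^^ k) f) = (\<zeta> * \<zeta>) ^ k * P f"
    "Q ((T ^^ k) f) = (inverse \<zeta> * inverse \<zeta>) ^ k * Q f" "I u ((T ^^ k) f) = I u f" for k u
    by (induction k) (simp_all add: P Q I)
  let ?g = "(T ^^ n) f"
  have PQ: "P ?g = P f" "Q ?g = Q f"
    using iter(1,2)[of n] z(1) by (simp_all add: power_mult_distrib power_inverse)
  \<comment> \<open>The two eigenfunctionals recover the values at \<open>w\<close> and
    \<open>v\<close>; the invariant \<open>I u\<close> then recovers the value at any
    \<open>u\<close>. Each time \<open>d\<close> is cancelled.\<close>
  have "P h + Q h = d * h w" for h by (simp add: P_def Q_def d_def algebra_simps)
  then have "d * ?g w = d * f w" using PQ by metis
  then have gw: "?g w = f w" using d0 by simp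
  then have gv: "?g v = f v" using PQ(1) by (simp add: P_def)
  have "?g = f"
  proof
    fix u
    have "I u ?g = I u f" by (rule iter(3))
    then have "d * ?g u = d * f u" by (simp add: I_def gv gw)
    then show "?g u = f u" using d0 by simp
  qed
  then show ?thesis by (simp only: T_def)
qed

section \<open>Permutation groups as finite targets\<close>

lemma carrier_BijGroup: "carrier (BijGroup D) = Bij D"
  and one_BijGroup: "\<one>\<^bsub>BijGroup D\<^esub> = (\<lambda>x\<in>D. x)"
  and mult_BijGroup: "g \<in> Bij D \<Longrightarrow> f \<in> Bij D \<Longrightarrow> g \<otimes>\<^bsub>BijGroup D\<^esub> f = compose D g f"
  by (simp_all add: BijGroup_def)

lemma BijGroup_pow:
  assumes F: "F \<in> D \<rightarrow> D" and g: "restrict F D \<in> Bij D"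
  shows "restrict F D [^]\<^bsub>BijGroup D\<^esub> (n::nat) = restrict (F ^^ n) D"
proof (induction n)
  case 0
  then show ?case by (simp add: one_BijGroup fun_eq_iff)
next
  case (Suc n)
  interpret group "BijGroup D" by (rule group_BijGroup)
  have p: "restrict F D [^]\<^bsub>BijGroup D\<^esub> n \<in> Bij D"
    using nat_pow_closed[of "restrict F D" n] g unfolding carrier_BijGroup by blast
  have "restrict F D [^]\<^bsub>BijGroup D\<^esub> Suc n
    = restrict F D [^]\<^bsub>BijGroup D\<^esub> n \<otimes>\<^bsub>BijGroup D\<^esub> restrict F D"
    by (rule nat_pow_Suc)
  also have "\<dots> = compose D (restrict (F ^^ n) D) (restrict F D)"
    using mult_BijGroup[OF p g] by (simp only: Suc)
  also have "\<dots> = restrict (F ^^ Suc n) D"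
  proof
    fix x
    have "x \<in> D \<Longrightarrow> F x \<in> D" using F by blast
    then show "compose D (restrict (F ^^ n) D) (restrict F D) x = restrict (F ^^ Suc n) D x"
      using funpow_swap1[of F n x] by (simp add: compose_def)
  qed
  finally show ?case .
qed

lemma finite_Bij: "finite D \<Longrightarrow> finite (Bij D)"
  by (rule finite_subset[OF _ finite_PiE[of D "\<lambda>_. D"]])
    (auto simp: Bij_def PiE_def bij_betw_def)

text \<open>The generators act by transvections on functions from \<open>V\<close> to a finite subfield containing the
  roots of unity attached to the odd labels; generators joined by an even label commute.\<close>

lemma separate_odd_edge:
  fixes V :: "'u set"
  assumes graph: "coxeter_graph V E m" and ab: "a \<in> V" "b \<in> V" "a \<noteq> b" "{a, b} \<in> E" "odd (m {a, b})"
  shows "\<exists>(D :: ('u \<Rightarrow> k2) set) s. finite D \<and> s \<in> cox_maps V E m (BijGroup D) \<and> s a \<noteq> s b"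
proof -
  have fV: "finite V" and lab: "\<And>e. e \<in> E \<Longrightarrow> 2 \<le> m e" using graph by (auto simp: coxeter_graph_def)
  have "E \<subseteq> Pow V" using graph by (auto simp: coxeter_graph_def)
  then have fE: "finite E" using fV by (meson finite_Pow_iff finite_subset)
  define z :: "nat \<Rightarrow> k2" where "z n = (SOME \<zeta>. \<zeta> ^ n = 1 \<and> \<zeta> \<noteq> 1)" for n
  have z: "z n ^ n = 1" "z n \<noteq> 1" if "odd n" "n > 1" for n
    using someI_ex[OF k2_root_of_unity[OF that]] by (simp_all add: z_def)
  \<comment> \<open>By Euler's theorem the odd number \<open>N\<close> divides 2^k - 1 for k =
    \<open>totient N\<close>, so the field with 2^k elements contains the chosen root of unity for
    every odd label at once.\<close>
  define N where "N = (\<Prod>e\<in>{e\<in>E. odd (m e)}. m e)"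
  define k where "k = totient N"
  have N: "odd N" unfolding N_def using fE by (subst even_prod_iff) auto
  then have "k > 0" by (auto simp: k_def intro: Nat.gr0I)
  have "coprime 2 N" using N by simp
  then have "[2 ^ k = 1] (mod N)" unfolding k_def by (rule euler_theorem)
  then have Ndvd: "N dvd 2 ^ k - 1" by (rule cong_to_1_nat)
  define S where "S = {x :: k2. x ^ 2 ^ k = x}"
  have fS: "finite S" unfolding S_def using \<open>k > 0\<close> by (rule finite_k2_fixed)
  have S: "0 \<in> S" "1 \<in> S" "x \<in> S \<Longrightarrow> y \<in> S \<Longrightarrow> x + y \<in> S" "x \<in> S \<Longrightarrow> y \<in> S \<Longrightarrow> x * y \<in> S"
    "x \<in> S \<Longrightarrow> inverse x \<in> S" for x y
    by (auto simp: S_def k2_frobenius power_mult_distrib power_inverse)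
  have zS: "z (m e) \<in> S" if "e \<in> E" "odd (m e)" for e
  proof -
    have "m e dvd N" unfolding N_def by (rule dvd_prodI) (use that fE in auto)
    then obtain j where "2 ^ k - 1 = m e * j" using Ndvd by (meson dvd_trans dvdE)
    then have "2 ^ k = Suc (m e * j)" by (metis One_nat_def Suc_pred zero_less_numeral zero_less_power)
    moreover have "z (m e) ^ (m e * j) = 1" using z(1)[OF that(2)] lab[OF that(1)] by (simp add: power_mult)
    ultimately show ?thesis by (simp add: S_def)
  qed
  define c where "c v w = (if v \<in> V \<and> w \<in> V \<and> v \<noteq> w \<and> {v, w} \<in> E \<and> odd (m {v, w})
    then z (m {v, w}) + inverse (z (m {v, w})) else 0)" for v w
  have c0: "c v v = 0" for v by (simp add: c_def)
  then have tt: "transv c v (transv c v f) = f" for v f by (intro transv_transv)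
  have cV: "w \<notin> V \<Longrightarrow> c v w = 0" for v w by (simp add: c_def)
  have cS: "c v w \<in> S" for v w using S zS by (auto simp: c_def)
  define D where "D = {f. (\<forall>v\<in>V. f v \<in> S) \<and> (\<forall>v. v \<notin> V \<longrightarrow> f v = 0)}"
  have "inj_on (\<lambda>f. restrict f V) D"
  proof (rule inj_onI)
    fix f g assume "f \<in> D" "g \<in> D" and eq: "restrict f V = restrict g V"
    then show "f = g"
      by (intro ext) (metis (mono_tags, lifting) D_def mem_Collect_eq restrict_apply')
  qed
  moreover have "(\<lambda>f. restrict f V) ` D \<subseteq> V \<rightarrow>\<^sub>E S" by (auto simp: D_def)
  ultimately have fD: "finite D"
    using finite_PiE[OF fV, of "\<lambda>_. S"] fS by (meson finite_imageD finite_subset)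
  have TD: "transv c v f \<in> D" if "f \<in> D" for v f
  proof -
    have "f w \<in> S" for w using that S(1) by (auto simp: D_def)
    then show ?thesis using that cS cV S by (auto simp: D_def transv_def)
  qed
  define s where "s = (\<lambda>v\<in>V. restrict (transv c v) D)"
  have sB: "restrict (transv c v) D \<in> Bij D" for v
    using bij_betw_byWitness[of D "transv c v" "transv c v" D] TD tt
    by (auto simp: Bij_def image_subset_iff)
  have mult: "restrict (transv c v) D \<otimes>\<^bsub>BijGroup D\<^esub> restrict (transv c w) D
      = restrict (transv c v \<circ> transv c w) D" for v w
    using TD by (simp add: mult_BijGroup[OF sB sB] compose_def fun_eq_iff)
  have pow: "((transv c v \<circ> transv c w) ^^ m {v, w}) f = f"
    if "v \<in> V" "w \<in> V" "v \<noteq> w" "{v, w} \<in> E" for v w f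
  proof (cases "even (m {v, w})")
    case True
    then show ?thesis using transv_pow_even[of c v w] c0 by (simp add: c_def insert_commute)
  next
    case False
    have "m {v, w} > 1" using lab[OF that(4)] by simp
    then show ?thesis
      using transv_pow_odd[of c v w "z (m {v, w})"] c0 z[OF False] that False
      by (simp add: c_def insert_commute)
  qed
  have "s \<in> cox_maps V E m (BijGroup D)"
  proof -
    have "restrict (transv c v) D \<otimes>\<^bsub>BijGroup D\<^esub> restrict (transv c v) D = \<one>\<^bsub>BijGroup D\<^esub>" for v
      by (simp add: mult one_BijGroup tt fun_eq_iff)
    moreover have "(restrict (transv c v) D \<otimes>\<^bsub>BijGroup D\<^esub> restrict (transv c w) D) [^]\<^bsub>BijGroup D\<^esub> m {v, w}
        = \<one>\<^bsub>BijGroup D\<^esub>" if "v \<in> V" "w \<in> V" "v \<noteq> w" "{v, w} \<in> E" for v w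
    proof -
      have "restrict (transv c v \<circ> transv c w) D \<in> Bij D"
        using sB by (simp add: mult_BijGroup compose_Bij flip: mult)
      moreover have "transv c v \<circ> transv c w \<in> D \<rightarrow> D" using TD by simp
      ultimately have "(restrict (transv c v) D \<otimes>\<^bsub>BijGroup D\<^esub> restrict (transv c w) D) [^]\<^bsub>BijGroup D\<^esub> m {v, w}
          = restrict ((transv c v \<circ> transv c w) ^^ m {v, w}) D"
        using BijGroup_pow by (simp only: mult)
      then show ?thesis
        using pow[OF that] by (simp add: one_BijGroup fun_eq_iff)
    qed
    ultimately show ?thesis
      using sB by (simp add: cox_maps_def s_def carrier_BijGroup)
  qed
  moreover have "s a \<noteq> s b"
  proof
    assume eq: "s a = s b"
    \<comment> \<open>On the delta function at \<open>a\<close>, the generator \<open>a\<close> adds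
      \<open>c a b\<close> at the point \<open>b\<close>, while the generator \<open>b\<close>
      changes nothing.\<close>
    define f where "f = (\<lambda>u. if u = a then 1 else 0 :: k2)"
    have "f \<in> D" using ab S by (auto simp: D_def f_def)
    then have "transv c a f b = transv c b f b"
      using fun_cong[OF eq, of f] ab by (simp add: s_def fun_eq_iff)
    then have "c a b = 0" using ab c0 by (simp add: transv_def f_def)
    moreover have "m {a, b} > 1" using lab[OF ab(4)] by simp
    ultimately have "z (m {a, b}) + inverse (z (m {a, b})) = 0" "z (m {a, b}) ^ m {a, b} = 1"
      "z (m {a, b}) \<noteq> 1"
      using ab z[OF ab(5)] by (simp_all add: c_def)
    moreover from this have "z (m {a, b}) * z (m {a, b}) = 1"
      using \<open>m {a, b} > 1\<close> by (metis k2_add_eq_0_iff right_inverse power_0_left not_one_less_zero zero_neq_one)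
    then have "(z (m {a, b}) + 1) * (z (m {a, b}) + 1) = 0" by (simp add: algebra_simps)
    ultimately show False by (simp add: k2_add_eq_0_iff)
  qed
  ultimately show ?thesis using fD by blast
qed

section \<open>Dihedral quotients\<close>

definition Z2 :: "bool monoid" where
  "Z2 = \<lparr>carrier = UNIV, monoid.mult = (\<noteq>), one = False\<rparr>"

text \<open>The dihedral group of order \<open>2 * n\<close>: the pair \<open>(k, False)\<close> is the rotation by \<open>k\<close>
  steps, and the pairs \<open>(k, True)\<close> are the reflections.\<close>

definition dih :: "nat \<Rightarrow> (int \<times> bool) monoid" where
  "dih n = \<lparr>carrier = {0..<int n} \<times> UNIV,
     monoid.mult = (\<lambda>(k, e) (l, f). ((if e then k - l else k + l) mod int n, e \<noteq> f)),
     one = (0, False)\<rparr>"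

lemma Z2_simps [simp]:
  "carrier Z2 = UNIV" "p \<otimes>\<^bsub>Z2\<^esub> q \<longleftrightarrow> p \<noteq> q" "\<one>\<^bsub>Z2\<^esub> = False"
  by (simp_all add: Z2_def)

lemma group_Z2: "group Z2"
  by (rule groupI) auto

lemma pow_Z2 [simp]: "(p [^]\<^bsub>Z2\<^esub> (n::nat)) \<longleftrightarrow> p \<and> odd n"
  by (induction n) (auto simp: monoid.nat_pow_Suc group.is_monoid[OF group_Z2])

lemma cox_maps_Z2_iff:
  "s \<in> cox_maps V E m Z2 \<longleftrightarrow> s \<in> extensional V \<and>
     (\<forall>v\<in>V. \<forall>w\<in>V. v \<noteq> w \<longrightarrow> {v, w} \<in> E \<longrightarrow> odd (m {v, w}) \<longrightarrow> s v = s w)"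
  by (auto simp: cox_maps_def PiE_def)

lemma dih_simps [simp]:
  "carrier (dih n) = {0..<int n} \<times> UNIV" "\<one>\<^bsub>dih n\<^esub> = (0, False)"
  "(k, e) \<otimes>\<^bsub>dih n\<^esub> (l, f) = ((if e then k - l else k + l) mod int n, e \<noteq> f)"
  by (simp_all add: dih_def)

lemma group_dih:
  assumes "n > 0"
  shows "group (dih n)"
proof (rule groupI)
  fix x y z assume "x \<in> carrier (dih n)" "y \<in> carrier (dih n)" "z \<in> carrier (dih n)"
  then show "x \<otimes>\<^bsub>dih n\<^esub> y \<otimes>\<^bsub>dih n\<^esub> z = x \<otimes>\<^bsub>dih n\<^esub> (y \<otimes>\<^bsub>dih n\<^esub> z)"
    by (cases x; cases y; cases z) (auto simp: mod_simps algebra_simps)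
next
  fix x assume x: "x \<in> carrier (dih n)"
  obtain k e where [simp]: "x = (k, e)" by (cases x)
  have "(if e then k else (- k) mod int n, e) \<in> carrier (dih n)"
    "(if e then k else (- k) mod int n, e) \<otimes>\<^bsub>dih n\<^esub> x = \<one>\<^bsub>dih n\<^esub>"
    using x assms by (auto simp: mod_simps)
  then show "\<exists>y\<in>carrier (dih n). y \<otimes>\<^bsub>dih n\<^esub> x = \<one>\<^bsub>dih n\<^esub>" by blast
qed (use assms in \<open>auto split: if_splits\<close>)

lemma pow_rotation: "n > 0 \<Longrightarrow> (k mod int n, False) [^]\<^bsub>dih n\<^esub> (l::nat) = (int l * k mod int n, False)"
  by (induction l)
    (auto simp: monoid.nat_pow_Suc group.is_monoid[OF group_dih] mod_simps algebra_simps)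

lemma finite_dih: "finite (carrier (dih n))"
  by simp

lemma dih_hom_mod:
  assumes "p dvd n" "p > 0"
  shows "(\<lambda>(k, e). (k mod int p, e)) \<in> hom (dih n) (dih p)"
proof -
  have "k mod int n mod int p = k mod int p" for k
    using assms by (intro mod_mod_cancel) simp
  then show ?thesis
    using assms by (auto simp: hom_def mod_simps)
qed

lemma dih_hom_snd: "snd \<in> hom (dih n) Z2"
  by (auto simp: hom_def)

lemma even_mod_int: "even n \<Longrightarrow> even (k mod int n) \<longleftrightarrow> even k"
  by (simp add: dvd_mod_iff)

text \<open>The characters dual to the generating reflections (1, True) and (0, True): applied to
  \<open>dih_map V x y\<close> they give the delta functions of \<open>y\<close> and of
  \<open>x\<close>.\<close>

lemma dih_hom_parity:
  assumes "even n"
  shows "(\<lambda>(k, e). odd k) \<in> hom (dih n) Z2" "(\<lambda>(k, e). odd k \<noteq> e) \<in> hom (dih n) Z2"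
  using assms by (auto simp: hom_def even_mod_int)

lemma (in group) pow_even_involution:
  assumes "g \<in> carrier G" "g \<otimes> g = \<one>" "even (n::nat)"
  shows "g [^] n = \<one>"
proof -
  obtain k where "n = 2 * k" using assms(3) by (elim evenE)
  moreover have "g [^] (2::nat) = \<one>" using assms by (simp add: numeral_2_eq_2)
  ultimately show ?thesis using assms(1) by (simp add: nat_pow_pow[symmetric])
qed

lemma (in group) subgroup_involution:
  assumes "g \<in> carrier G" "g \<otimes> g = \<one>"
  shows "subgroup {\<one>, g} G"
  by (rule subgroupI) (use assms inv_equality[of g g] in auto)

definition dih_map :: "'v set \<Rightarrow> 'v \<Rightarrow> 'v \<Rightarrow> 'v \<Rightarrow> int \<times> bool" where
  "dih_map V x y = (\<lambda>z\<in>V. if z = x then (0, True) else if z = y then (1, True) else (0, False))"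

text \<open>On an edge other than {x, y} one value is trivial and the other squares to 1, so an even
  label suffices. If {x, y} is not an edge, any n > 1 is allowed.\<close>

lemma dih_map_maps:
  assumes n: "n > 1" and even: "\<And>e. e \<in> E \<Longrightarrow> even (m e)"
    and xy: "x \<noteq> y" "{x, y} \<in> E \<Longrightarrow> n dvd m {x, y}"
  shows "dih_map V x y \<in> cox_maps V E m (dih n)"
proof -
  interpret group "dih n" using n by (intro group_dih) simp
  have closed: "dih_map V x y v \<in> carrier (dih n)" and inv: "dih_map V x y v \<otimes>\<^bsub>dih n\<^esub> dih_map V x y v = \<one>\<^bsub>dih n\<^esub>"
    if "v \<in> V" for v
    using that n by (auto simp: dih_map_def)
  have "(dih_map V x y v \<otimes>\<^bsub>dih n\<^esub> dih_map V x y w) [^]\<^bsub>dih n\<^esub> m {v, w} = \<one>\<^bsub>dih n\<^esub>"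
    if vw: "v \<in> V" "w \<in> V" "v \<noteq> w" "{v, w} \<in> E" for v w
  proof (cases "{v, w} = {x, y}")
    case True
    then have "n dvd m {v, w}" using xy vw by simp
    then have "int n dvd int (m {v, w}) * k" for k by simp
    moreover obtain k where "dih_map V x y v \<otimes>\<^bsub>dih n\<^esub> dih_map V x y w = (k mod int n, False)"
      using True vw xy by (auto simp: dih_map_def doubleton_eq_iff)
    ultimately show ?thesis
      using n by (simp add: pow_rotation mod_eq_0_iff_dvd)
  next
    case False
    then have "dih_map V x y v = \<one>\<^bsub>dih n\<^esub> \<or> dih_map V x y w = \<one>\<^bsub>dih n\<^esub>"
      using vw by (auto simp: dih_map_def)
    then have "dih_map V x y v \<otimes>\<^bsub>dih n\<^esub> dih_map V x y w \<in> {dih_map V x y v, dih_map V x y w}"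
      using closed vw r_one l_one by (metis insertCI)
    then show ?thesis
      using pow_even_involution[OF closed inv even] vw
      by (metis (no_types, lifting) insertE singletonD)
  qed
  then show ?thesis
    using closed inv by (auto simp: cox_maps_def dih_map_def)
qed

section \<open>The coloring of the generators\<close>

context cox_transfer
begin

lemma even_label: "e \<in> E \<Longrightarrow> even (m e)"
  using div4[of e] by (meson dvd_trans even_numeral)

definition ind :: "'v set \<Rightarrow> 'v \<Rightarrow> bool" where
  "ind S = (\<lambda>z\<in>V. z \<in> S)"

lemma ind_maps: "ind S \<in> cox_maps V E m Z2"
  using even_label by (auto simp: cox_maps_Z2_iff ind_def)

lemmas Z2 = group_Z2 finite[of "carrier Z2"]

text \<open>Otherwise the generator \<open>a\<close> would go to a rotation of \<open>dih 4\<close>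
  by an odd number of steps, whose square is not trivial.\<close>

lemma tr_ind_disjoint:
  assumes "a \<in> V'" "x \<in> V" "y \<in> V" "x \<noteq> y" "tr Z2 (ind {x}) a" "tr Z2 (ind {y}) a"
  shows False
proof -
  have s: "dih_map V x y \<in> cox_maps V E m (dih 4)"
    by (rule dih_map_maps) (use even_label div4 assms in auto)
  have G: "group (dih 4)" by (rule group_dih) simp
  obtain k e where ke: "tr (dih 4) (dih_map V x y) a = (k, e)" by (cases "tr (dih 4) (dih_map V x y) a")
  have "(\<lambda>z\<in>V. (\<lambda>(k, e). odd k) (dih_map V x y z)) = ind {y}"
    "(\<lambda>z\<in>V. (\<lambda>(k, e). odd k \<noteq> e) (dih_map V x y z)) = ind {x}"
    using assms by (auto simp: ind_def dih_map_def fun_eq_iff)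
  then have "odd k" "odd k \<noteq> e"
    using tr_nat[OF G finite_dih Z2 s dih_hom_parity(1) assms(1)]
      tr_nat[OF G finite_dih Z2 s dih_hom_parity(2) assms(1)] assms ke by simp_all
  moreover have "(k, e) \<otimes>\<^bsub>dih 4\<^esub> (k, e) = \<one>\<^bsub>dih 4\<^esub>"
    using cox_mapsD(3)[OF tr_maps[OF G finite_dih s] assms(1)] ke by simp
  ultimately show False by simp presburger
qed

text \<open>Naturality for the addition of Z/2 makes \<open>tr\<close> additive, so the left side is
  a sum over \<open>S\<close>. At most one summand is nonzero, which turns the sum into an
  existential statement.\<close>

lemma tr_ind:
  assumes a: "a \<in> V'" and S: "S \<subseteq> V"
  shows "tr Z2 (ind S) a \<longleftrightarrow> (\<exists>x\<in>S. tr Z2 (ind {x}) a)"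
proof -
  have "finite S" using S finite_V by (rule finite_subset)
  then show ?thesis using S
  proof (induction S)
    case empty
    have "(\<lambda>_. False) \<in> hom Z2 Z2" by (auto simp: hom_def)
    from tr_nat[OF Z2 Z2 ind_maps[of "{}"] this a] have "\<not> tr Z2 (\<lambda>z\<in>V. False) a" by simp
    moreover have "(\<lambda>z\<in>V. False) = ind {}" by (simp add: ind_def)
    ultimately show ?case by simp
  next
    case (insert x S)
    let ?G = "Z2 \<times>\<times> Z2"
    define s where "s = (\<lambda>z\<in>V. (z \<in> S, z = x))"
    have G: "group ?G" "finite (carrier ?G)" by (auto simp: DirProd_group group_Z2)
    have pow: "(p, q) [^]\<^bsub>?G\<^esub> n = (p [^]\<^bsub>Z2\<^esub> n, q [^]\<^bsub>Z2\<^esub> n)" for p q and n :: nat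
      by (induction n) (auto simp: monoid.nat_pow_Suc group.is_monoid[OF G(1)] group.is_monoid[OF group_Z2])
    have s: "s \<in> cox_maps V E m ?G"
      using even_label by (auto simp: cox_maps_def s_def pow)
    have h: "fst \<in> hom ?G Z2" "snd \<in> hom ?G Z2" "(\<lambda>(p, q). p \<noteq> q) \<in> hom ?G Z2"
      by (auto simp: hom_def)
    have "(\<lambda>z\<in>V. fst (s z)) = ind S" "(\<lambda>z\<in>V. snd (s z)) = ind {x}"
      "(\<lambda>z\<in>V. (\<lambda>(p, q). p \<noteq> q) (s z)) = ind (insert x S)"
      using insert by (auto simp: s_def ind_def fun_eq_iff)
    then have *: "tr Z2 (ind (insert x S)) a \<longleftrightarrow> tr Z2 (ind S) a \<noteq> tr Z2 (ind {x}) a"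
      using tr_nat[OF G Z2 s h(1) a] tr_nat[OF G Z2 s h(2) a] tr_nat[OF G Z2 s h(3) a]
      by (simp add: case_prod_unfold)
    show ?case
      using insert tr_ind_disjoint[OF a, of x] by (auto simp: *)
  qed
qed

lemma restrict_maps:
  assumes "s \<in> cox_maps U F l G"
  shows "restrict s U = s"
  using cox_mapsD(1)[OF assms] by (simp add: PiE_def extensional_restrict)

lemma Z2_map_eq_ind:
  assumes "s \<in> cox_maps V E m Z2"
  shows "s = ind {x\<in>V. s x}"
proof -
  have "restrict s V = ind {x\<in>V. s x}" by (simp add: ind_def fun_eq_iff)
  with restrict_maps[OF assms] show ?thesis by metis
qed

text \<open>For existence, the constant map True on \<open>V'\<close> is a transfer, hence the
  transfer of some \<open>ind S\<close>; being true at \<open>a\<close>, it forces one of the delta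
  functions of \<open>S\<close> to be true there.\<close>

lemma ex1_color:
  assumes a: "a \<in> V'"
  shows "\<exists>!x. x \<in> V \<and> tr Z2 (ind {x}) a"
proof -
  have t: "(\<lambda>b\<in>V'. True) \<in> cox_maps V' E' m' Z2" by (simp add: cox_maps_Z2_iff)
  define s where "s = tr_inv Z2 (\<lambda>b\<in>V'. True)"
  have "s \<in> cox_maps V E m Z2" unfolding s_def by (rule tr_inv_maps[OF Z2 t])
  then have "tr Z2 (ind {x\<in>V. s x}) a"
    using tr_tr_inv[OF Z2 t] Z2_map_eq_ind a by (metis restrict_apply' s_def)
  then have "\<exists>x\<in>{x\<in>V. s x}. tr Z2 (ind {x}) a"
    using tr_ind[OF a, of "{x\<in>V. s x}"] by auto
  then show ?thesis using tr_ind_disjoint[OF a] by blast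
qed

definition color :: "'u \<Rightarrow> 'v" where
  "color a = (THE x. x \<in> V \<and> tr Z2 (ind {x}) a)"

lemma color:
  assumes "a \<in> V'"
  shows "color a \<in> V" "x \<in> V \<Longrightarrow> tr Z2 (ind {x}) a \<longleftrightarrow> color a = x"
  using theI'[OF ex1_color[OF assms]] ex1_color[OF assms] by (auto simp: color_def)

lemma tr_Z2:
  assumes "s \<in> cox_maps V E m Z2" "a \<in> V'"
  shows "tr Z2 s a \<longleftrightarrow> s (color a)"
proof -
  have "tr Z2 (ind {x\<in>V. s x}) a \<longleftrightarrow> (\<exists>x\<in>{x\<in>V. s x}. tr Z2 (ind {x}) a)"
    by (rule tr_ind[OF assms(2)]) auto
  then show ?thesis using color[OF assms(2)] Z2_map_eq_ind[OF assms(1)] by auto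
qed

lemma tr_ind_iff: "a \<in> V' \<Longrightarrow> tr Z2 (ind S) a \<longleftrightarrow> color a \<in> S"
  unfolding tr_Z2[OF ind_maps] using color(1) by (simp add: ind_def)

text \<open>Every such map is a transfer, and transfers to Z/2 only see colors.\<close>

lemma Z2_map_color:
  assumes "t \<in> cox_maps V' E' m' Z2" "a \<in> V'" "b \<in> V'" "color a = color b"
  shows "t a = t b"
  using tr_Z2[OF tr_inv_maps[OF Z2 assms(1)]] assms tr_tr_inv[OF Z2 assms(1)] by simp

lemma tr_inj:
  assumes "group G" "finite (carrier G)" "s \<in> cox_maps V E m G" "r \<in> cox_maps V E m G"
    and "\<And>a. a \<in> V' \<Longrightarrow> tr G s a = tr G r a"
  shows "s = r"
proof -
  have "tr G s = tr G r"
    by (rule cox_maps_ext[OF tr_maps[OF assms(1-3)] tr_maps[OF assms(1,2,4)] assms(5)])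
  then have "tr_inv G (tr G s) = tr_inv G (tr G r)" by (rule arg_cong)
  then show ?thesis unfolding tr_inv_tr[OF assms(1-3)] tr_inv_tr[OF assms(1,2,4)] .
qed

text \<open>The delta function of a missing color would have the same transfer as the zero
  function.\<close>

lemma color_surj:
  assumes x: "x \<in> V"
  shows "\<exists>a\<in>V'. color a = x"
proof (rule ccontr)
  assume *: "\<not> ?thesis"
  have "ind {x} = ind {}"
    by (rule tr_inj[OF Z2 ind_maps ind_maps]) (use * x in \<open>auto simp: tr_ind_iff\<close>)
  then show False using x by (auto simp: ind_def fun_eq_iff split: if_splits)
qed

lemma color_odd_edge:
  assumes ab: "a \<in> V'" "b \<in> V'" "a \<noteq> b" "{a, b} \<in> E'" "odd (m' {a, b})"
  shows "color a = color b"
proof -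
  have "tr Z2 (ind {color b}) a = tr Z2 (ind {color b}) b"
    using tr_maps[OF Z2 ind_maps] ab by (simp add: cox_maps_Z2_iff)
  then show ?thesis using color[OF ab(1)] color[OF ab(2)] by metis
qed

section \<open>Labels of edges between different colors\<close>

lemma tr_dih_map:
  assumes n: "even n" "n > 1" and s: "dih_map V x y \<in> cox_maps V E m (dih n)"
    and xy: "x \<in> V" "y \<in> V" "x \<noteq> y" and a: "a \<in> V'"
  shows "odd (fst (tr (dih n) (dih_map V x y) a)) \<longleftrightarrow> color a = y"
    "snd (tr (dih n) (dih_map V x y) a) \<longleftrightarrow> color a \<in> {x, y}"
proof -
  have G: "group (dih n)" using n by (intro group_dih) simp
  have eq: "(\<lambda>z\<in>V. (\<lambda>(k, e). odd k) (dih_map V x y z)) = ind {y}"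
    "(\<lambda>z\<in>V. snd (dih_map V x y z)) = ind {x, y}"
    using xy by (auto simp: ind_def dih_map_def fun_eq_iff)
  have "tr Z2 (ind {y}) a = (\<lambda>(k, e). odd k) (tr (dih n) (dih_map V x y) a)"
    unfolding eq(1)[symmetric] by (rule tr_nat[OF G finite_dih Z2 s dih_hom_parity(1)[OF n(1)] a])
  then show "odd (fst (tr (dih n) (dih_map V x y) a)) \<longleftrightarrow> color a = y"
    using color(2)[OF a xy(2)] by (simp add: case_prod_unfold)
  have "tr Z2 (ind {x, y}) a = snd (tr (dih n) (dih_map V x y) a)"
    unfolding eq(2)[symmetric] by (rule tr_nat[OF G finite_dih Z2 s dih_hom_snd a])
  then show "snd (tr (dih n) (dih_map V x y) a) \<longleftrightarrow> color a \<in> {x, y}"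
    by (simp add: tr_ind_iff[OF a])
qed

text \<open>The product of two reflections is the rotation by the difference of their first
  components, and the label annihilates it.\<close>

lemma rotation_part:
  assumes n: "n > 0" and g: "g \<in> cox_maps U F l (dih n)"
    and ab: "a \<in> U" "b \<in> U" "a \<noteq> b" "{a, b} \<in> F" "snd (g a)" "snd (g b)"
  shows "int n dvd int (l {a, b}) * (fst (g a) - fst (g b))"
proof -
  obtain k k' where k: "g a = (k, True)" "g b = (k', True)" using ab by (metis prod.collapse)
  have "((k - k') mod int n, False) [^]\<^bsub>dih n\<^esub> l {a, b} = (0, False)"
    using cox_mapsD(4)[OF g ab(1-4)] k by simp
  then show ?thesis using n k by (simp add: pow_rotation mod_eq_0_iff_dvd)
qed

text \<open>The parities at \<open>a\<close> and \<open>b\<close> differ, so the product of the two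
  reflections of \<open>dih 4\<close> has order 4. This weak form comes first because
  \<open>fiber_constant\<close>, on which \<open>label_dvd\<close> rests, needs even labels between
  colors.\<close>

lemma label_div4:
  assumes ab: "a \<in> V'" "b \<in> V'" "a \<noteq> b" "{a, b} \<in> E'" "color a \<noteq> color b"
  shows "4 dvd m' {a, b}"
proof -
  let ?s = "dih_map V (color a) (color b)"
  let ?g = "tr (dih 4) ?s"
  have s: "?s \<in> cox_maps V E m (dih 4)"
    by (rule dih_map_maps) (use even_label div4 ab in auto)
  have G: "group (dih 4)" by (rule group_dih) simp
  note c = color(1)[OF ab(1)] color(1)[OF ab(2)]
  have "odd (fst (?g a) - fst (?g b))" "snd (?g a)" "snd (?g b)"
    using tr_dih_map[OF _ _ s c ab(5)] ab by auto
  moreover from this have "4 dvd int (m' {a, b}) * (fst (?g a) - fst (?g b))"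
    using rotation_part[OF _ tr_maps[OF G finite_dih s] ab(1-4)] by simp
  ultimately have "4 dvd int (m' {a, b})"
    using coprime_dvd_mult_left_iff[of 4 "fst (?g a) - fst (?g b)"]
      coprime_power_left_iff[of 2 2 "fst (?g a) - fst (?g b)"] by simp
  then show ?thesis by presburger
qed

lemma even_involution:
  assumes "odd p" "0 \<le> k" "k < int p" "(k, False) \<otimes>\<^bsub>dih p\<^esub> (k, False) = \<one>\<^bsub>dih p\<^esub>"
  shows "k = 0"
proof -
  have "(k + k) mod int p = 0" using assms(4) by simp
  then have "int p dvd 2 * k" unfolding mult_2 by (rule mod_0_imp_dvd)
  moreover have "coprime (int p) 2" using assms(1) by simp
  ultimately have "int p dvd k" using coprime_dvd_mult_right_iff by blast
  then show ?thesis using mod_pos_pos_trivial[OF assms(2,3)] by simp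
qed

lemma odd_dih_rotation:
  assumes p: "odd p" and t: "t \<in> cox_maps U F l (dih p)" and c: "c \<in> U" "\<not> snd (t c)"
  shows "t c = \<one>\<^bsub>dih p\<^esub>"
proof -
  obtain k where k: "t c = (k, False)" using c(2) by (cases "t c") simp
  have "(k, False) \<in> carrier (dih p)" "(k, False) \<otimes>\<^bsub>dih p\<^esub> (k, False) = \<one>\<^bsub>dih p\<^esub>"
    using cox_mapsD(2,3)[OF t c(1)] by (simp_all only: k)
  then have "k = 0" by (intro even_involution[OF p]) simp_all
  then show ?thesis using k by simp
qed

text \<open>As \<open>tr\<close> is injective on maps to \<open>Z2\<close>, \<open>t\<close> is the transfer of a map \<open>s\<close> which sends \<open>v\<close> to a
  reflection and all other vertices to rotations; these are trivial because \<open>p\<close> is odd. So \<open>s\<close>, and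
  hence \<open>t\<close>, takes values in the group of order 2 generated by \<open>s v\<close>.\<close>

lemma dih_map_diagonal:
  assumes p: "odd p" and t: "t \<in> cox_maps V' E' m' (dih p)" and v: "v \<in> V"
    and supp: "\<And>a. a \<in> V' \<Longrightarrow> snd (t a) \<longleftrightarrow> color a = v"
    and ab: "a \<in> V'" "b \<in> V'" "color a = v" "color b = v"
  shows "t a = t b"
proof -
  have G: "group (dih p)" using p by (intro group_dih) (auto intro: Nat.gr0I)
  define s where "s = tr_inv (dih p) t"
  have s: "s \<in> cox_maps V E m (dih p)" unfolding s_def by (rule tr_inv_maps[OF G finite_dih t])
  have ts: "tr (dih p) s = t" unfolding s_def by (rule tr_tr_inv[OF G finite_dih t])
  have "(\<lambda>x\<in>V. snd (s x)) = ind {v}"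
  proof (rule tr_inj[OF Z2 cox_maps_comp[OF s dih_hom_snd G group_Z2] ind_maps])
    fix a assume a: "a \<in> V'"
    have "tr Z2 (\<lambda>x\<in>V. snd (s x)) a = snd (t a)"
      using tr_nat[OF G finite_dih Z2 s dih_hom_snd a] by (simp add: ts)
    then show "tr Z2 (\<lambda>x\<in>V. snd (s x)) a = tr Z2 (ind {v}) a"
      using supp[OF a] color(2)[OF a v] by simp
  qed
  then have snd_s: "snd (s x) \<longleftrightarrow> x = v" if "x \<in> V" for x
    using that by (auto simp: ind_def fun_eq_iff split: if_splits)
  have "s x = \<one>\<^bsub>dih p\<^esub>" if "x \<in> V" "x \<noteq> v" for x
    using odd_dih_rotation[OF p s that(1)] snd_s that by blast
  then have "s ` V \<subseteq> {\<one>\<^bsub>dih p\<^esub>, s v}" by blast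
  moreover have "subgroup {\<one>\<^bsub>dih p\<^esub>, s v} (dih p)"
    by (rule group.subgroup_involution[OF G]) (use cox_mapsD[OF s] v in blast)+
  ultimately have image: "t ` V' \<subseteq> {\<one>\<^bsub>dih p\<^esub>, s v}"
    using tr_image_subset_iff[OF G finite_dih s] by (simp only: ts)
  have "t c = s v" if "c \<in> V'" "color c = v" for c
  proof -
    have "t c \<noteq> \<one>\<^bsub>dih p\<^esub>" using supp[OF that(1)] that(2) by auto
    then show ?thesis using subsetD[OF image imageI[OF that(1)]] by simp
  qed
  then show ?thesis using ab by metis
qed

text \<open>Replace \<open>t\<close> by the identity off the color \<open>v\<close>. Edges inside a
  color keep or lose both values, and edges between colors have even labels, so the relators survive
  and \<open>dih_map_diagonal\<close> applies.\<close>

lemma fiber_constant: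
  assumes p: "odd p" and t: "t \<in> cox_maps V' E' m' (dih p)" and v: "v \<in> V"
    and supp: "\<And>a. a \<in> V' \<Longrightarrow> color a = v \<Longrightarrow> snd (t a)"
    and ab: "a \<in> V'" "b \<in> V'" "color a = v" "color b = v"
  shows "t a = t b"
proof -
  have "p > 0" using p by (auto intro: Nat.gr0I)
  then interpret group "dih p" by (rule group_dih)
  define r where "r = (\<lambda>a\<in>V'. if color a = v then t a else \<one>\<^bsub>dih p\<^esub>)"
  note t' = cox_mapsD[OF t]
  have "r \<in> cox_maps V' E' m' (dih p)"
  proof -
    have "(r a \<otimes>\<^bsub>dih p\<^esub> r b) [^]\<^bsub>dih p\<^esub> m' {a, b} = \<one>\<^bsub>dih p\<^esub>"
      if ab: "a \<in> V'" "b \<in> V'" "a \<noteq> b" "{a, b} \<in> E'" for a b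
    proof (cases "color a = color b")
      case True
      then show ?thesis using ab t'(4)[OF ab] by (simp add: r_def del: dih_simps)
    next
      case False
      have "even (m' {a, b})" using label_div4[OF ab False] by (meson dvd_trans even_numeral)
      then have "t a [^]\<^bsub>dih p\<^esub> m' {a, b} = \<one>\<^bsub>dih p\<^esub>" "t b [^]\<^bsub>dih p\<^esub> m' {a, b} = \<one>\<^bsub>dih p\<^esub>"
        using pow_even_involution t' ab by metis+
      then show ?thesis using ab False t'(2) by (auto simp: r_def simp del: dih_simps)
    qed
    then show ?thesis
      using t'(2,3) by (auto simp: cox_maps_def r_def simp del: dih_simps)
  qed
  moreover have "snd (r a) \<longleftrightarrow> color a = v" if "a \<in> V'" for a
    using supp that by (simp add: r_def)
  ultimately have "r a = r b" using dih_map_diagonal[OF p _ v] ab by blast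
  then show ?thesis using ab by (simp add: r_def)
qed

text \<open>The transferred map sends \<open>a\<close> and \<open>b\<close> to reflections with product the rotation by an odd \<open>j\<close>.
  A common prime factor \<open>p\<close> of \<open>j\<close> and \<open>n\<close> is impossible: modulo \<open>p\<close> the transferred map is constant
  on each color by the previous lemma, so its image would lie in a group of order 2.\<close>

lemma label_dvd:
  assumes ab: "a \<in> V'" "b \<in> V'" "a \<noteq> b" "{a, b} \<in> E'" "color a \<noteq> color b"
    and n: "4 dvd n" "n > 0" "{color a, color b} \<in> E \<Longrightarrow> n dvd m {color a, color b}"
  shows "n dvd m' {a, b}"
proof -
  define x y where "x = color a" and "y = color b"
  have xy: "x \<in> V" "y \<in> V" "x \<noteq> y" using ab color by (auto simp: x_def y_def)
  have n4: "n > 1" "even n" using n(1,2) by (auto dest: dvd_imp_le intro: dvd_trans)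
  have s: "dih_map V x y \<in> cox_maps V E m (dih n)"
    by (rule dih_map_maps) (use even_label n n4 xy x_def y_def in auto)
  have G: "group (dih n)" using n by (intro group_dih)
  define g where "g = tr (dih n) (dih_map V x y)"
  have g: "g \<in> cox_maps V' E' m' (dih n)" unfolding g_def by (rule tr_maps[OF G finite_dih s])
  have gsnd: "snd (g c) \<longleftrightarrow> color c \<in> {x, y}" and gfst: "odd (fst (g c)) \<longleftrightarrow> color c = y" if "c \<in> V'" for c
    unfolding g_def using tr_dih_map[OF n4(2,1) s xy that] by auto
  define j where "j = fst (g a) - fst (g b)"
  have odd: "odd j" using gfst[OF ab(1)] gfst[OF ab(2)] ab by (simp add: j_def y_def)
  have dvd: "int n dvd int (m' {a, b}) * j"
    unfolding j_def using rotation_part[OF n(2) g ab(1-4)] gsnd[OF ab(1)] gsnd[OF ab(2)] by (simp add: x_def y_def)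
  have "coprime (int n) j"
  proof (rule ccontr)
    assume "\<not> coprime (int n) j"
    then have "\<bar>gcd (int n) j\<bar> \<noteq> 1" by (simp add: coprime_iff_gcd_eq_1)
    then obtain q where "Factorial_Ring.prime q" "q dvd gcd (int n) j"
      using prime_factor_int by blast
    then have q: "Factorial_Ring.prime q" "q dvd int n" "q dvd j"
      by (simp_all del: gcd_int_int_eq)
    define p where "p = nat q"
    have qp: "q = int p" using q(1) by (simp add: p_def prime_ge_0_int)
    have p: "Factorial_Ring.prime p" "p dvd n" "int p dvd j" using q by (simp_all add: qp)
    have "p \<noteq> 2" using p(3) odd by auto
    then have podd: "odd p" and p3: "p > 2" using p(1) prime_odd_nat prime_ge_2_nat[of p] by force+
    have H: "group (dih p)" using p3 by (intro group_dih) simp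
    let ?r = "\<lambda>(k, e). (k mod int p, e)"
    have r: "?r \<in> hom (dih n) (dih p)" by (rule dih_hom_mod) (use p p3 in auto)
    define t where "t = (\<lambda>c\<in>V'. ?r (g c))"
    have t: "t \<in> cox_maps V' E' m' (dih p)" unfolding t_def by (rule cox_maps_comp[OF g r G H])
    define u where "u = (\<lambda>z\<in>V. ?r (dih_map V x y z))"
    have u: "u \<in> cox_maps V E m (dih p)" unfolding u_def by (rule cox_maps_comp[OF s r G H])
    have tu: "tr (dih p) u = t"
    proof (rule cox_maps_ext[OF tr_maps[OF H finite_dih u] t])
      show "tr (dih p) u c = t c" if "c \<in> V'" for c
        using tr_nat[OF G finite_dih H finite_dih s r that] that by (simp add: u_def t_def g_def)
    qed
    have tsnd: "snd (t c) \<longleftrightarrow> color c \<in> {x, y}" if "c \<in> V'" for c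
      using gsnd[OF that] that by (simp add: t_def case_prod_unfold)
    have "t a = t b"
      using p(3) gsnd[OF ab(1)] gsnd[OF ab(2)] ab by (auto simp: t_def case_prod_unfold j_def x_def y_def mod_eq_dvd_iff)
    \<comment> \<open>Each of the two colors contributes a single reflection, these coincide modulo
      \<open>p\<close>, and every other generator goes to a trivial rotation.\<close>
    have "t c \<in> {\<one>\<^bsub>dih p\<^esub>, t a}" if c: "c \<in> V'" for c
    proof -
      consider "color c = x" | "color c = y" | "color c \<notin> {x, y}" by blast
      then show ?thesis
      proof cases
        case 1
        then have "t c = t a" by (intro fiber_constant[OF podd t xy(1)]) (use tsnd c ab x_def in auto)
        then show ?thesis by simp
      next
        case 2
        then have "t c = t b" by (intro fiber_constant[OF podd t xy(2)]) (use tsnd c ab y_def in auto)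
        then show ?thesis using \<open>t a = t b\<close> by simp
      next
        case 3
        then have "t c = \<one>\<^bsub>dih p\<^esub>" using tsnd[OF c] by (intro odd_dih_rotation[OF podd t c]) simp
        then show ?thesis by simp
      qed
    qed
    then have "tr (dih p) u ` V' \<subseteq> {\<one>\<^bsub>dih p\<^esub>, t a}" unfolding tu by blast
    moreover have "subgroup {\<one>\<^bsub>dih p\<^esub>, t a} (dih p)"
      by (rule group.subgroup_involution[OF H]) (use cox_mapsD[OF t] ab in blast)+
    ultimately have "u ` V \<subseteq> {\<one>\<^bsub>dih p\<^esub>, t a}"
      using tr_image_subset_iff[OF H finite_dih u] by blast
    \<comment> \<open>Both values of \<open>u\<close> are reflections, hence equal to
      \<open>t a\<close>; but they are the distinct generating reflections.\<close>
    then have "u x \<in> {\<one>\<^bsub>dih p\<^esub>, t a}" "u y \<in> {\<one>\<^bsub>dih p\<^esub>, t a}" using xy by blast+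
    moreover have "u x = (0, True)" "u y = (1, True)" using xy p3 by (auto simp: u_def dih_map_def)
    ultimately have "(0, True) = t a" "(1, True) = t a" by auto
    then show False by (metis prod.inject zero_neq_one)
  qed
  then have "int n dvd int (m' {a, b})" using dvd by (simp add: coprime_dvd_mult_left_iff)
  then show ?thesis by simp
qed

lemma label_pos': "e' \<in> E' \<Longrightarrow> m' e' \<ge> 2" and label_pos: "e \<in> E \<Longrightarrow> m e \<ge> 2"
  using graph graph' by (auto simp: coxeter_graph_def)

lemma edge_color:
  assumes ab: "a \<in> V'" "b \<in> V'" "a \<noteq> b" "{a, b} \<in> E'" "color a \<noteq> color b"
  shows "{color a, color b} \<in> E" "m {color a, color b} dvd m' {a, b}"
proof -
  show edge: "{color a, color b} \<in> E"
  proof (rule ccontr)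
    assume "{color a, color b} \<notin> E"
    \<comment> \<open>Without an edge below, \<open>label_dvd\<close> allows every positive multiple
      of 4, in particular one exceeding the label.\<close>
    then have "4 * m' {a, b} dvd m' {a, b}"
      using label_pos'[OF ab(4)] by (intro label_dvd[OF ab]) auto
    then show False using label_pos'[OF ab(4)] by (auto dest: dvd_imp_le)
  qed
  show "m {color a, color b} dvd m' {a, b}"
    using label_pos[OF edge] div4[OF edge] by (intro label_dvd[OF ab]) auto
qed

section \<open>Factorization through the color map\<close>

lemma color_pullback:
  assumes G: "group G" and s: "s \<in> cox_maps V E m G"
  shows "(\<lambda>a\<in>V'. s (color a)) \<in> cox_maps V' E' m' G"
proof -
  interpret group G by fact
  note s' = cox_mapsD[OF s]
  have "(s (color a) \<otimes>\<^bsub>G\<^esub> s (color b)) [^]\<^bsub>G\<^esub> m' {a, b} = \<one>\<^bsub>G\<^esub>"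
    if ab: "a \<in> V'" "b \<in> V'" "a \<noteq> b" "{a, b} \<in> E'" for a b
  proof (cases "color a = color b")
    case True
    then show ?thesis using s'(3)[OF color(1)] ab by simp
  next
    case False
    note edge = edge_color[OF ab False]
    obtain k where "m' {a, b} = m {color a, color b} * k" using edge(2) by (elim dvdE)
    moreover have "(s (color a) \<otimes>\<^bsub>G\<^esub> s (color b)) [^]\<^bsub>G\<^esub> m {color a, color b} = \<one>\<^bsub>G\<^esub>"
      using s'(4) color(1) ab False edge(1) by simp
    moreover have "s (color a) \<otimes>\<^bsub>G\<^esub> s (color b) \<in> carrier G"
      using s'(2) color(1) ab by simp
    ultimately show ?thesis by (simp add: nat_pow_pow[symmetric])
  qed
  then show ?thesis using s'(2,3) color(1) by (auto simp: cox_maps_def)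
qed

text \<open>Pulling back along \<open>color\<close> is injective, and the two sets have the same finite cardinality.\<close>

lemma ex_color_factor:
  assumes G: "group G" "finite (carrier G)" and t: "t \<in> cox_maps V' E' m' G"
  shows "\<exists>s\<in>cox_maps V E m G. t = (\<lambda>a\<in>V'. s (color a))"
proof -
  let ?F = "\<lambda>s. \<lambda>a\<in>V'. s (color a)"
  have "inj_on ?F (cox_maps V E m G)"
  proof (rule inj_onI)
    fix s r assume sr: "s \<in> cox_maps V E m G" "r \<in> cox_maps V E m G" and eq: "?F s = ?F r"
    show "s = r"
    proof (rule cox_maps_ext[OF sr])
      fix x assume "x \<in> V"
      then obtain a where "a \<in> V'" "color a = x" using color_surj by blast
      then show "s x = r x" using fun_cong[OF eq, of a] by simp
    qed
  qed
  then have "card (?F ` cox_maps V E m G) = card (cox_maps V' E' m' G)"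
    using bij_betw_same_card[OF bij_tr[OF G]] by (simp add: card_image)
  moreover have "?F ` cox_maps V E m G \<subseteq> cox_maps V' E' m' G"
    using color_pullback[OF G(1)] by blast
  ultimately have "?F ` cox_maps V E m G = cox_maps V' E' m' G"
    using finite_cox_maps[OF finite_V' G(2)] by (intro card_subset_eq) auto
  then show ?thesis using t by blast
qed

text \<open>Factoring through \<open>color\<close> would identify the ends of an odd edge in every
  finite quotient, against \<open>separate_odd_edge\<close>.\<close>

lemma even_label':
  assumes "a \<in> V'" "b \<in> V'" "a \<noteq> b" "{a, b} \<in> E'"
  shows "even (m' {a, b})"
proof (rule ccontr)
  assume odd: "odd (m' {a, b})"
  obtain D :: "('u \<Rightarrow> k2) set" and s where D: "finite D" "s \<in> cox_maps V' E' m' (BijGroup D)" "s a \<noteq> s b"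
    using separate_odd_edge[OF graph' assms odd] by blast
  have "finite (carrier (BijGroup D))" using finite_Bij[OF D(1)] by (simp add: carrier_BijGroup)
  then obtain r where "s = (\<lambda>a\<in>V'. r (color a))"
    using ex_color_factor[OF group_BijGroup _ D(2)] by blast
  then show False using D(3) color_odd_edge[OF assms odd] assms by simp
qed

text \<open>With all labels even, the delta function of a generator is a map to Z/2, and it must be
  constant on colors.\<close>

lemma bij_color: "bij_betw color V' V"
proof -
  have "a = b" if "a \<in> V'" "b \<in> V'" "color a = color b" for a b
  proof -
    have "(\<lambda>c\<in>V'. c = a) \<in> cox_maps V' E' m' Z2"
      using even_label' by (auto simp: cox_maps_Z2_iff)
    from Z2_map_color[OF this that] show ?thesis using that by simp
  qed
  then have "inj_on color V'" by (rule inj_onI)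
  moreover have "color ` V' = V" using color(1) color_surj by force
  ultimately show ?thesis by (simp add: bij_betw_def)
qed

text \<open>A dihedral map of the second group factors through \<open>color\<close>, placing
  generating reflections at the two colors. Their product has order \<open>n\<close>, which
  therefore divides the label below.\<close>

lemma edge_color_conv:
  assumes ab: "a \<in> V'" "b \<in> V'" "a \<noteq> b" "{color a, color b} \<in> E"
  shows "{a, b} \<in> E'" "m' {a, b} dvd m {color a, color b}"
proof -
  have ne: "color a \<noteq> color b" using bij_color ab by (auto simp: bij_betw_def inj_on_def)
  have dvd: "n dvd m {color a, color b}" if n: "n > 1" "{a, b} \<in> E' \<Longrightarrow> n dvd m' {a, b}" for n
  proof -
    have G: "group (dih n)" using n by (intro group_dih) simp
    have "E' \<subseteq> {{v, w} |v w. v \<in> V' \<and> w \<in> V' \<and> v \<noteq> w}" using graph' by (simp add: coxeter_graph_def)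
    then have "dih_map V' a b \<in> cox_maps V' E' m' (dih n)"
      using even_label' by (intro dih_map_maps) (use n ab in auto)
    then obtain s where s: "s \<in> cox_maps V E m (dih n)" "dih_map V' a b = (\<lambda>c\<in>V'. s (color c))"
      using ex_color_factor[OF G finite_dih] by blast
    have "s (color a) = (0, True)" "s (color b) = (1, True)"
      using fun_cong[OF s(2), of a] fun_cong[OF s(2), of b] ab by (simp_all add: dih_map_def)
    then have "int n dvd int (m {color a, color b}) * (0 - 1)"
      using rotation_part[OF _ s(1) color(1)[OF ab(1)] color(1)[OF ab(2)] ne ab(4)] n by simp
    then show ?thesis by simp
  qed
  show edge: "{a, b} \<in> E'"
  proof (rule ccontr)
    assume "{a, b} \<notin> E'"
    \<comment> \<open>If {a, b} were not an edge, \<open>n\<close> would be unrestricted; the factor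
      4 only makes it exceed the label.\<close>
    then have "4 * m {color a, color b} dvd m {color a, color b}"
      using label_pos[OF ab(4)] by (intro dvd) auto
    then show False using label_pos[OF ab(4)] by (auto dest: dvd_imp_le)
  qed
  show "m' {a, b} dvd m {color a, color b}"
    using label_pos'[OF edge] by (intro dvd) auto
qed

lemma coxeter_groups_iso: "\<Gamma>' \<cong> \<Gamma>"
proof (rule coxeter_group_iso[OF bij_color])
  fix a b assume ab: "a \<in> V'" "b \<in> V'" "a \<noteq> b"
  then have ne: "color a \<noteq> color b" using bij_color by (auto simp: bij_betw_def inj_on_def)
  show "{a, b} \<in> E' \<longleftrightarrow> {color a, color b} \<in> E"
    using edge_color(1)[OF ab _ ne] edge_color_conv(1)[OF ab] by blast
  show "m' {a, b} = m {color a, color b}" if "{a, b} \<in> E'"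
    using edge_color[OF ab that ne] edge_color_conv(2)[OF ab] by (auto intro: dvd_antisym)
qed

end

theorem theorem9p6:
  fixes V :: "'v set" and E :: "'v set set" and m :: "'v set \<Rightarrow> nat"
    and V' :: "'u set" and E' :: "'u set set" and m' :: "'u set \<Rightarrow> nat"
    and W :: "('w, 'z) monoid_scheme"
  assumes "coxeter_graph V E m"
    and "\<forall>e\<in>E. 4 dvd m e"
    and "coxeter_graph V' E' m'"
    and "group W"
    and "W \<cong> coxeter_group V' E' m'"
    and "profinite_iso W (coxeter_group V E m)"
  shows "W \<cong> coxeter_group V E m"
proof -
  obtain \<phi> \<psi> where \<phi>: "prof_cont W (coxeter_group V E m) \<phi>" "prof_cont (coxeter_group V E m) W \<psi>"
    "\<And>x. x \<in> carrier (profinite_completion W) \<Longrightarrow> \<psi> (\<phi> x) = x"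
    "\<And>y. y \<in> carrier (profinite_completion (coxeter_group V E m)) \<Longrightarrow> \<phi> (\<psi> y) = y"
    by (rule profinite_isoE[OF assms(4) group_coxeter_group assms(6)], rule that)
  obtain \<kappa> where \<kappa>: "\<kappa> \<in> iso W (coxeter_group V' E' m')"
    using assms(5) by (auto simp: is_iso_def)
  define \<iota> where "\<iota> = inv_into (carrier W) \<kappa>"
  have \<iota>: "\<iota> \<in> iso (coxeter_group V' E' m') W"
    unfolding \<iota>_def by (rule group.iso_set_sym[OF assms(4) \<kappa>])
  have bij: "bij_betw \<kappa> (carrier W) (carrier (coxeter_group V' E' m'))"
    using \<kappa> by (simp add: iso_def)
  have "\<iota> (\<kappa> w) = w" if "w \<in> carrier W" for w
    using bij that by (simp add: \<iota>_def bij_betw_inv_into_left)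
  moreover have "\<kappa> (\<iota> A) = A" if "A \<in> carrier (coxeter_group V' E' m')" for A
    using bij that by (simp add: \<iota>_def bij_betw_inv_into_right)
  ultimately interpret cox_transfer V E m V' E' m' W \<phi> \<psi> \<iota> \<kappa>
    using assms(1-4) \<phi> \<kappa> \<iota> by (intro cox_transfer.intro) (simp_all add: iso_def)
  show ?thesis
    using assms(5) coxeter_groups_iso by (rule iso_trans)
qed

end
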